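(* There are complete partite graphs $F$ for which $i(F)$ is rational, yet $i_k(F)$ is irrational for some $k$. The smallest such graph (in terms of number of vertices) is $K_{3,1,1}$, for which $i(K_{3,1,1})=\frac{216}{625}$, yet $i_5(K_{3,1,1})$ is irrational.
   Context: All graphs are finite and simple. $K_{a_1,\ldots,a_r}$ is the complete $r$-partite graph with part sizes $a_1,\ldots,a_r$. For graphs $F,G$, $P(F,G)$ is the number of $|V(F)|$-subsets of $V(G)$ inducing a subgraph isomorphic to $F$, and $p(F,G)=P(F,G)/\binom{|V(G)|}{|V(F)|}$. $i(F,n)$ is the maximum of $p(F,G)$ over all $n$-vertex graphs $G$, and, for $k\ge 2$, $i_k(F,n)$ is the maximum over all $n$-vertex graphs not containing $K_k$ as a subgraph; $i(F)=\lim_{n\to\infty}i(F,n)$ and $i_k(F)=\lim_{n\to\infty}i_k(F,n)$ (the limits exist). *)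

theory Defs
  imports Complex_Main "Graph_Theory.Graph_Theory"
begin

text \<open>
  A finite simple graph is a \<open>pair_graph\<close>: finitely many vertices together with a symmetric
  irreflexive set of arcs, each edge being represented by its two opposite arcs.
  On such graphs \<open>digraph_iso\<close> is ordinary graph isomorphism, since the arc map of an isomorphism
  is determined by its vertex map.
\<close>

definition K_partite :: "nat list \<Rightarrow> (nat \<times> nat) pair_pre_digraph" where
  "K_partite as =
     (let V = {(i, j). i < length as \<and> j < as ! i}
      in \<lparr> pverts = V, parcs = {(u, v). u \<in> V \<and> v \<in> V \<and> fst u \<noteq> fst v} \<rparr>)"

definition complete_partite :: "'a pair_pre_digraph \<Rightarrow> bool" where
  "complete_partite F \<longleftrightarrow>
     (\<exists>as. as \<noteq> [] \<and> 0 \<notin> set as \<and> digraph_iso (with_proj (K_partite as)) (with_proj F))"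

definition induced_count :: "'a pair_pre_digraph \<Rightarrow> 'b pair_pre_digraph \<Rightarrow> nat" where
  "induced_count F G =
     card {S. S \<subseteq> pverts G \<and> card S = card (pverts F)
              \<and> digraph_iso (with_proj F) (with_proj G \<restriction> S)}"

text \<open>
  For graphs \<open>G\<close> with fewer vertices than \<open>F\<close> the quotient is \<open>0 / 0 = 0\<close>; this does not affect limits.
\<close>

definition induced_density :: "'a pair_pre_digraph \<Rightarrow> 'b pair_pre_digraph \<Rightarrow> real" where
  "induced_density F G =
     real (induced_count F G) / real (card (pverts G) choose card (pverts F))"

definition contains_clique :: "nat \<Rightarrow> 'a pair_pre_digraph \<Rightarrow> bool" where
  "contains_clique k G \<longleftrightarrow> (\<exists>H. subgraph H (with_proj G) \<and> complete_digraph k H)"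

text \<open>
  Taking vertices in \<open>nat\<close> covers all graphs on \<open>n\<close> vertices up to isomorphism. The maxima are over
  finite sets of values, because the counts are bounded by a binomial coefficient.
\<close>

definition max_density :: "'a pair_pre_digraph \<Rightarrow> nat \<Rightarrow> real" where
  "max_density F n =
     Max {induced_density F G | G :: nat pair_pre_digraph. pair_graph G \<and> card (pverts G) = n}"

definition max_density_clique_free :: "nat \<Rightarrow> 'a pair_pre_digraph \<Rightarrow> nat \<Rightarrow> real" where
  "max_density_clique_free k F n =
     Max {induced_density F G | G :: nat pair_pre_digraph.
            pair_graph G \<and> card (pverts G) = n \<and> \<not> contains_clique k G}"

definition inducibility :: "'a pair_pre_digraph \<Rightarrow> real" where
  "inducibility F = lim (\<lambda>n. max_density F n)"

text \<open>Meaningful for \<open>k \<ge> 2\<close> only.\<close>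

definition inducibility_clique_free :: "nat \<Rightarrow> 'a pair_pre_digraph \<Rightarrow> real" where
  "inducibility_clique_free k F = lim (\<lambda>n. max_density_clique_free k F n)"

definition rational_yet_irrational :: "'a pair_pre_digraph \<Rightarrow> bool" where
  "rational_yet_irrational F \<longleftrightarrow>
     inducibility F \<in> \<rat> \<and> (\<exists>k\<ge>2. inducibility_clique_free k F \<notin> \<rat>)"

end

theory Submission
  imports
    Defs
    "HOL-Analysis.Analysis"
    "HOL-Combinatorics.Permutations"
    "HOL-Computational_Algebra.Primes"
begin

text \<open>
  The proof turns clique-free inducibility into a polynomial optimization problem and then shows
  that irrational maxima cannot occur on at most five vertices, except for \<open>K_{3,1,1}\<close>.

  \<^bold>\<open>Reduction.\<close> Let \<open>F\<close> be complete partite. Replacing a vertex \<open>u\<close> by a clone of a non-neighbour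
  \<open>v\<close> keeps every induced copy of \<open>F\<close> that contains both vertices, because non-adjacent vertices of
  a copy are twins inside it. Hence one of the two possible replacements does not lower the number of
  copies, no clique is created, and a graph that is extremal and has as many pairs of twins as possible
  is complete partite (\<open>symmetrization\<close>). In such a graph the copies are counted by a sum over
  assignments of the parts of \<open>F\<close> to the colour classes (\<open>profile_sum\<close>). Passing to the limit,
  \<open>i_{q+1}(F)\<close> is \<open>|F|!\<close> times the maximum over all probability vectors \<open>x\<close> of length \<open>q\<close> of the polynomial
  in which a part of size \<open>a\<close> placed into class \<open>i\<close> has the weight \<open>x_i^a / a!\<close>
  (\<open>max_density_clique_free_limit\<close>).

  \<^bold>\<open>Rational cases.\<close> Fix all classes but two, and the sum of these two. If no two parts of \<open>F\<close> have the sizes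
  3 and 1 or 4 and 1, and \<open>|F| \<le> 5\<close>, then the polynomial is a convex function, of degree at most two, of the product
  of the two classes, so that it is largest when they are equal or when one of them vanishes. A maximizer of minimal
  support is therefore uniform on its support, and the maximum is rational. The two remaining graphs are
  the stars \<open>K_{3,1}\<close> and \<open>K_{4,1}\<close>, for which two classes suffice and the maximum is rational
  although the maximizer for \<open>K_{4,1}\<close> is not.

  \<^bold>\<open>The graph \<open>K_{3,1,1}\<close>.\<close> Its polynomial is, up to a factor, \<open>p3 (1 - p2) - 2 p4 + 2 p5\<close> in the power sums of the
  vector. Without a bound on the number of classes the supremum corresponds to a single large class of weight
  3/5 and a clique on the rest, which gives \<open>216/625\<close>. With four classes the best vector has one large
  class and three equal small ones; the small weight is a root of \<open>40 b^2 - 19 b + 2\<close>, and the value is a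
  rational number plus a nonzero rational multiple of \<open>b\<close>, hence irrational.
\<close>

section \<open>Counting sets with prescribed intersection sizes\<close>

text \<open>
  The weight \<open>w x a\<close> is collected when a part of size \<open>a\<close> is placed into the class \<open>x\<close>; each class receives at
  most one part and all parts of \<open>A\<close> must be placed. With binomial coefficients as weights this counts vertex sets,
  with \<open>x ^ a / a!\<close> it is the limiting density polynomial. The recursion avoids sums over injections and
  corrections for equal part sizes.
\<close>

primrec profile_sum :: "('x \<Rightarrow> nat \<Rightarrow> 'b::comm_semiring_1) \<Rightarrow> nat multiset \<Rightarrow> 'x list \<Rightarrow> 'b" where
  "profile_sum w A [] = (if A = {#} then 1 else 0)"
| "profile_sum w A (x # xs) =
     profile_sum w A xs + (\<Sum>a\<in>set_mset A. w x a * profile_sum w (A - {#a#}) xs)"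

lemma profile_sum_empty [simp]: "profile_sum w {#} xs = 1"
  by (induction xs) auto

lemma profile_sum_map: "profile_sum w A (map f xs) = profile_sum (\<lambda>x. w (f x)) A xs"
  by (induction xs arbitrary: A) auto

lemma profile_sum_cong:
  assumes "\<And>x a. x \<in> set xs \<Longrightarrow> a \<in># A \<Longrightarrow> w x a = w' x a"
  shows "profile_sum w A xs = profile_sum w' A xs"
  using assms
proof (induction xs arbitrary: A)
  case (Cons x xs)
  have "profile_sum w (A - {#a#}) xs = profile_sum w' (A - {#a#}) xs" for a
    by (rule Cons.IH) (use Cons.prems in \<open>auto dest: in_diffD\<close>)
  moreover have "profile_sum w A xs = profile_sum w' A xs"
    by (rule Cons.IH) (use Cons.prems in auto)
  ultimately show ?case using Cons.prems by (auto intro!: sum.cong)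
qed simp

lemma of_nat_profile_sum:
  "of_nat (profile_sum w A xs) = profile_sum (\<lambda>x a. of_nat (w x a)) A xs"
  by (induction xs arbitrary: A) auto

lemma profile_sum_nonneg:
  fixes w :: "'x \<Rightarrow> nat \<Rightarrow> 'b::linordered_semidom"
  assumes "\<And>x a. x \<in> set xs \<Longrightarrow> a \<in># A \<Longrightarrow> 0 \<le> w x a"
  shows "0 \<le> profile_sum w A xs"
  using assms
proof (induction xs arbitrary: A)
  case (Cons x xs)
  have "0 \<le> profile_sum w (A - {#a#}) xs" for a
    by (rule Cons.IH) (use Cons.prems in \<open>auto dest: in_diffD\<close>)
  moreover have "0 \<le> profile_sum w A xs"
    by (rule Cons.IH) (use Cons.prems in auto)
  ultimately show ?case using Cons.prems by (auto intro!: add_nonneg_nonneg sum_nonneg mult_nonneg_nonneg)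
qed simp

lemma profile_sum_mono:
  fixes w :: "'x \<Rightarrow> nat \<Rightarrow> 'b::linordered_semidom"
  assumes "\<And>x a. x \<in> set xs \<Longrightarrow> a \<in># A \<Longrightarrow> 0 \<le> w x a \<and> w x a \<le> w' x a"
  shows "profile_sum w A xs \<le> profile_sum w' A xs"
  using assms
proof (induction xs arbitrary: A)
  case (Cons x xs)
  have *: "profile_sum w (A - {#a#}) xs \<le> profile_sum w' (A - {#a#}) xs" for a
    by (rule Cons.IH) (use Cons.prems in \<open>auto dest: in_diffD\<close>)
  have **: "0 \<le> profile_sum w (A - {#a#}) xs" for a
    by (rule profile_sum_nonneg) (use Cons.prems in \<open>auto dest: in_diffD\<close>)
  have "profile_sum w A xs \<le> profile_sum w' A xs"
    by (rule Cons.IH) (use Cons.prems in auto)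
  then show ?case using Cons.prems * **
    by (auto intro!: add_mono sum_mono mult_mono dest: order_trans)
qed simp

lemma profile_sum_scale:
  fixes w :: "'x \<Rightarrow> nat \<Rightarrow> 'b::comm_semiring_1"
  shows "profile_sum (\<lambda>x a. c ^ a * w x a) A xs = c ^ sum_mset A * profile_sum w A xs"
proof (induction xs arbitrary: A)
  case (Cons x xs)
  have "c ^ a * w x a * profile_sum (\<lambda>x a. c ^ a * w x a) (A - {#a#}) xs =
      c ^ sum_mset A * (w x a * profile_sum w (A - {#a#}) xs)" if "a \<in># A" for a
  proof -
    have "sum_mset A = a + sum_mset (A - {#a#})"
      using sum_mset.remove[OF that] by simp
    then show ?thesis by (simp add: Cons.IH power_add mult_ac)
  qed
  then show ?case by (simp add: Cons.IH distrib_left sum_distrib_left)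
qed simp

lemma tendsto_profile_sum:
  fixes w :: "'n \<Rightarrow> 'x \<Rightarrow> nat \<Rightarrow> real"
  assumes "\<And>x a. x \<in> set xs \<Longrightarrow> a \<in># A \<Longrightarrow> ((\<lambda>n. w n x a) \<longlongrightarrow> v x a) F"
  shows "((\<lambda>n. profile_sum (w n) A xs) \<longlongrightarrow> profile_sum v A xs) F"
  using assms
proof (induction xs arbitrary: A)
  case (Cons x xs)
  have "((\<lambda>n. profile_sum (w n) (A - {#a#}) xs) \<longlongrightarrow> profile_sum v (A - {#a#}) xs) F" for a
    by (rule Cons.IH) (use Cons.prems in \<open>auto dest: in_diffD\<close>)
  moreover have "((\<lambda>n. profile_sum (w n) A xs) \<longlongrightarrow> profile_sum v A xs) F"
    by (rule Cons.IH) (use Cons.prems in auto)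
  ultimately show ?case using Cons.prems by (auto intro!: tendsto_intros)
qed simp

text \<open>
  Processing one class is a linear operator on functions of the multiset \<open>A\<close>. Two such operators commute, since
  choosing first \<open>a\<close> and then \<open>b\<close> from \<open>A\<close> leaves the same multiset as the other order.
\<close>

lemma profile_sum_swap: "profile_sum w A (x # y # zs) = profile_sum w A (y # x # zs)"
proof -
  let ?P = "SIGMA a:set_mset A. set_mset (A - {#a#})"
  have P: "prod.swap ` ?P = ?P"
    by (auto simp: image_iff in_diff_count Bex_def count_greater_zero_iff split: if_splits)
  have inj: "inj_on prod.swap ?P" by simp
  define f where "f = (\<lambda>u v (a,b). w u a * (w v b * profile_sum w (A - {#a#} - {#b#}) zs))"
  have dbl: "(\<Sum>a\<in>set_mset A. w u a * (\<Sum>b\<in>set_mset (A - {#a#}). w v b * profile_sum w (A - {#a#} - {#b#}) zs))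
      = sum (f u v) ?P" for u v
    unfolding f_def by (subst sum.Sigma [symmetric]) (auto simp: sum_distrib_left)
  have "sum (f x y) ?P = sum (f x y) (prod.swap ` ?P)" by (simp only: P)
  also have "\<dots> = sum (f x y \<circ> prod.swap) ?P" by (rule sum.reindex[OF inj])
  also have "\<dots> = sum (f y x) ?P"
    unfolding f_def by (rule sum.cong) (auto simp: mult_ac add_mset_commute)
  finally have eq: "sum (f x y) ?P = sum (f y x) ?P" .
  show ?thesis
    by (simp only: profile_sum.simps(2) distrib_left sum.distrib dbl eq add_ac)
qed

lemma profile_sum_mset:
  assumes "mset xs = mset ys"
  shows "profile_sum w A xs = profile_sum w A ys"
proof -
  define T where "T = (\<lambda>x h A. h A + (\<Sum>a\<in>set_mset A. w x a * h (A - {#a#}) :: 'b))"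
  define z where "z = (\<lambda>A::nat multiset. if A = {#} then 1 else 0 :: 'b)"
  have T: "T x (\<lambda>A. profile_sum w A ys) = (\<lambda>A. profile_sum w A (x # ys))" for x ys
    by (simp add: T_def)
  have fold: "fold T xs (\<lambda>A. profile_sum w A ys) = (\<lambda>A. profile_sum w A (rev xs @ ys))" for xs ys
    by (induction xs arbitrary: ys) (simp_all add: T del: profile_sum.simps)
  have fold0: "(\<lambda>A. profile_sum w A xs) = fold T (rev xs) z" for xs
    using fold[of "rev xs" "[]"] by (simp add: z_def)
  define P where "P = (\<lambda>h. \<exists>zs. h = (\<lambda>A. profile_sum w A zs))"
  have "fold T (rev xs) z = fold T (rev ys) z"
  proof (rule fold_permuted_eq[where P = P])
    show "mset (rev xs) = mset (rev ys)" using assms by simp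
    show "P z" unfolding P_def z_def by (rule exI[of _ "[]"]) simp
    show "P (T x h)" if "P h" for x h
    proof -
      obtain zs where "h = (\<lambda>A. profile_sum w A zs)" using \<open>P h\<close> unfolding P_def by blast
      then have "T x h = (\<lambda>A. profile_sum w A (x # zs))" by (simp add: T_def)
      then show ?thesis unfolding P_def by blast
    qed
    show "T x (T y h) = T y (T x h)" if "P h" for x y h
    proof -
      obtain zs where h: "h = (\<lambda>A. profile_sum w A zs)" using \<open>P h\<close> unfolding P_def by blast
      have "T u (T v h) = (\<lambda>A. profile_sum w A (u # v # zs))" for u v by (simp add: T_def h)
      then show ?thesis by (simp only: profile_sum_swap)
    qed
  qed
  then show ?thesis using fold0 by metis
qed

text \<open>
  A set with the required intersection sizes either misses the first block or meets it in one of the binomially many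
  subsets of some size \<open>a\<close> in \<open>A\<close>; this is the recursion of \<open>profile_sum\<close>. Zero must not be a member of \<open>A\<close>, because
  an empty intersection is not recorded.
\<close>

lemma card_sets_with_profile:
  assumes "\<And>X. X \<in> set Vs \<Longrightarrow> finite X" "sorted_wrt (\<lambda>X Y. X \<inter> Y = {}) Vs" "0 \<notin># A"
  shows "card {S. S \<subseteq> \<Union>(set Vs) \<and> mset (filter (\<lambda>d. d \<noteq> 0) (map (\<lambda>X. card (S \<inter> X)) Vs)) = A}
      = profile_sum (\<lambda>X a. card X choose a) A Vs"
  using assms
proof (induction Vs arbitrary: A)
  case (Cons X Vs)
  define U where "U = \<Union>(set Vs)"
  define C where "C = (\<lambda>A. {S. S \<subseteq> U \<and> mset (filter (\<lambda>d. d \<noteq> 0) (map (\<lambda>X. card (S \<inter> X)) Vs)) = A})"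
  have disj: "X \<inter> U = {}" and fin: "finite X" "finite U"
    using Cons.prems by (auto simp: U_def)
  have finC: "finite (C A)" for A unfolding C_def using fin by auto
  have IH: "card (C A) = profile_sum (\<lambda>X a. card X choose a) A Vs" if "0 \<notin># A" for A
    using Cons.IH[of A] Cons.prems that by (auto simp: C_def U_def)
  define D where "D = (\<lambda>a. (\<lambda>(T, S'). T \<union> S') ` ({T. T \<subseteq> X \<and> card T = a} \<times> C (A - {#a#})))"
  have inj: "inj_on (\<lambda>(T, S'). T \<union> S') ({T. T \<subseteq> X \<and> card T = a} \<times> C B)" for a B
    using disj by (auto simp: inj_on_def C_def) blast+
  have cardD: "card (D a) = (card X choose a) * card (C (A - {#a#}))" for a
    unfolding D_def by (simp add: card_image[OF inj] card_cartesian_product n_subsets fin)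
  have finD: "finite (D a)" for a
    unfolding D_def using fin finC by (auto intro!: finite_imageI finite_cartesian_product)
  have rest: "map (\<lambda>Y. card ((T \<union> S') \<inter> Y)) Vs = map (\<lambda>Y. card (S' \<inter> Y)) Vs" if "T \<subseteq> X" for T S'
  proof (rule map_cong[OF refl])
    fix Y assume "Y \<in> set Vs"
    then have "(T \<union> S') \<inter> Y = S' \<inter> Y" using that disj by (auto simp: U_def)
    then show "card ((T \<union> S') \<inter> Y) = card (S' \<inter> Y)" by simp
  qed
  have Dprop: "S \<inter> X \<subseteq> X \<and> card (S \<inter> X) = a" if "S \<in> D a" for S a
  proof -
    obtain T S' where "T \<subseteq> X" "card T = a" "S' \<subseteq> U" "S = T \<union> S'"
      using \<open>S \<in> D a\<close> by (auto simp: D_def C_def)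
    moreover then have "S \<inter> X = T" using disj by auto
    ultimately show ?thesis by auto
  qed
  have main: "{S. S \<subseteq> \<Union>(set (X # Vs)) \<and> mset (filter (\<lambda>d. d \<noteq> 0) (map (\<lambda>Y. card (S \<inter> Y)) (X # Vs))) = A}
      = C A \<union> (\<Union>a\<in>set_mset A. D a)" (is "?L = ?R")
  proof (intro equalityI subsetI)
    fix S assume S: "S \<in> ?L"
    define T where "T = S \<inter> X"
    define S' where "S' = S \<inter> U"
    have SU: "S = T \<union> S'" using S by (auto simp: T_def S'_def U_def)
    have TX: "T \<subseteq> X" "S' \<subseteq> U" by (auto simp: T_def S'_def)
    have mp: "map (\<lambda>Y. card (S \<inter> Y)) Vs = map (\<lambda>Y. card (S' \<inter> Y)) Vs"
      unfolding SU by (rule rest[OF TX(1)])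
    show "S \<in> ?R"
    proof (cases "T = {}")
      case True
      have "S \<inter> X = {}" using True by (simp add: T_def)
      moreover have "S \<subseteq> U" using SU TX(2) True by blast
      ultimately have "S \<in> C A" using S by (simp add: C_def)
      then show ?thesis by simp
    next
      case False
      then have c: "card T \<noteq> 0" using fin TX by (meson card_0_eq finite_subset)
      have "mset (filter (\<lambda>d. d \<noteq> 0) (card T # map (\<lambda>Y. card (S' \<inter> Y)) Vs)) = A"
        unfolding mp[symmetric] T_def using S by (simp only: mem_Collect_eq list.map)
      then have A: "A = add_mset (card T) (mset (filter (\<lambda>d. d \<noteq> 0) (map (\<lambda>Y. card (S' \<inter> Y)) Vs)))"
        using c by simp
      then have "card T \<in># A" "S' \<in> C (A - {#card T#})" using TX by (auto simp: C_def)
      then have "S \<in> D (card T)" unfolding D_def SU using TX by (auto intro!: image_eqI[of _ _ "(T, S')"])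
      then show ?thesis using \<open>card T \<in># A\<close> by auto
    qed
  next
    fix S assume "S \<in> ?R"
    then consider "S \<in> C A" | a where "a \<in># A" "S \<in> D a" by auto
    then show "S \<in> ?L"
    proof cases
      case 1
      then have "S \<inter> X = {}" using disj by (auto simp: C_def)
      then show ?thesis using 1 by (auto simp: C_def U_def)
    next
      case 2
      then obtain T S' where T: "T \<subseteq> X" "card T = a" "S' \<subseteq> U" "S = T \<union> S'" "S' \<in> C (A - {#a#})"
        by (auto simp: D_def C_def)
      have "S \<inter> X = T" using disj T(1,3,4) by blast
      have "a \<noteq> 0" using 2 Cons.prems by metis
      have mp: "map (\<lambda>Y. card (S \<inter> Y)) Vs = map (\<lambda>Y. card (S' \<inter> Y)) Vs"
        unfolding T by (rule rest[OF T(1)])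
      have "mset (filter (\<lambda>d. d \<noteq> 0) (map (\<lambda>Y. card (S \<inter> Y)) Vs)) = A - {#a#}"
        unfolding mp using T(5) by (simp add: C_def)
      then have "mset (filter (\<lambda>d. d \<noteq> 0) (map (\<lambda>Y. card (S \<inter> Y)) (X # Vs))) = A"
        using 2 \<open>a \<noteq> 0\<close> \<open>S \<inter> X = T\<close> T(2) by simp
      moreover have "S \<subseteq> \<Union>(set (X # Vs))" using T by (auto simp: U_def)
      ultimately show ?thesis by (simp only: mem_Collect_eq simp_thms)
    qed
  qed
  have not_in: "0 \<notin># A - {#a#}" for a using Cons.prems(3) by (meson in_diffD)
  have "C A \<inter> (\<Union>a\<in>set_mset A. D a) = {}"
  proof -
    have "card (S \<inter> X) = 0" if "S \<in> C A" for S
      using that disj by (auto simp: C_def intro!: card_eq_0_iff[THEN iffD2])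
    then show ?thesis using Dprop Cons.prems(3) by fastforce
  qed
  then have "card (C A \<union> (\<Union>a\<in>set_mset A. D a)) = card (C A) + card (\<Union>a\<in>set_mset A. D a)"
    using finC finD by (intro card_Un_disjoint) auto
  also have "card (\<Union>a\<in>set_mset A. D a) = (\<Sum>a\<in>set_mset A. card (D a))"
    using finD Dprop by (intro card_UN_disjoint) (simp, simp, blast)
  finally show ?case
    unfolding main using IH[OF Cons.prems(3)] IH[OF not_in] by (simp add: cardD)
qed (simp add: Collect_conv_if)

section \<open>Induced copies and colour classes\<close>

text \<open>
  Over a bare edge relation, so that graph surgery need not rebuild graph records.
\<close>

definition induces :: "'a pair_pre_digraph \<Rightarrow> 'b rel \<Rightarrow> 'b set \<Rightarrow> bool" where
  "induces F R S \<longleftrightarrow> (\<exists>f. bij_betw f (pverts F) S \<and>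
     (\<forall>u\<in>pverts F. \<forall>v\<in>pverts F. (u, v) \<in> parcs F \<longleftrightarrow> (f u, f v) \<in> R))"

definition copies :: "'a pair_pre_digraph \<Rightarrow> 'b set \<Rightarrow> 'b rel \<Rightarrow> 'b set set" where
  "copies F V R = {S. S \<subseteq> V \<and> induces F R S}"

text \<open>
  A digraph isomorphism also carries an arc map and end maps. Between graphs whose arcs are pairs these are forced by
  the vertex map.
\<close>

lemma digraph_iso_iff_induces:
  assumes F: "parcs F \<subseteq> pverts F \<times> pverts F"
  shows "digraph_iso (with_proj F) (with_proj G \<restriction> S) \<longleftrightarrow> induces F (parcs G) S"
proof
  assume "digraph_iso (with_proj F) (with_proj G \<restriction> S)"
  then obtain h where h: "pre_digraph.digraph_isomorphism (with_proj F) h"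
    and eq: "with_proj G \<restriction> S = app_iso h (with_proj F)"
    by (auto simp: digraph_iso_def)
  define f where "f = iso_verts h"
  have inj: "inj_on f (pverts F)"
    using h by (auto simp: pre_digraph.digraph_isomorphism_def f_def)
  have "verts (with_proj G \<restriction> S) = f ` pverts F" by (simp add: eq f_def)
  then have S: "S = f ` pverts F" by simp
  have tl: "iso_tail h = fst" "iso_head h = snd"
    using arg_cong[OF eq, of tail] arg_cong[OF eq, of head] by simp_all
  have arc: "iso_arcs h (u, v) = (f u, f v)" if "(u, v) \<in> parcs F" for u v
    using h that by (auto simp: pre_digraph.digraph_isomorphism_def f_def tl intro!: prod_eqI)
  have "{e \<in> parcs G. fst e \<in> S \<and> snd e \<in> S} = iso_arcs h ` parcs F"
    using arg_cong[OF eq, of arcs] by simp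
  also have "\<dots> = (\<lambda>(u, v). (f u, f v)) ` parcs F"
    by (rule image_cong[OF refl]) (auto simp: arc)
  finally have R: "{e \<in> parcs G. fst e \<in> S \<and> snd e \<in> S} = (\<lambda>(u, v). (f u, f v)) ` parcs F" .
  have "(u, v) \<in> parcs F \<longleftrightarrow> (f u, f v) \<in> parcs G" if uv: "u \<in> pverts F" "v \<in> pverts F" for u v
  proof
    assume "(u, v) \<in> parcs F"
    then have "(f u, f v) \<in> (\<lambda>(u, v). (f u, f v)) ` parcs F" by force
    then show "(f u, f v) \<in> parcs G" using R by blast
  next
    assume "(f u, f v) \<in> parcs G"
    then have "(f u, f v) \<in> {e \<in> parcs G. fst e \<in> S \<and> snd e \<in> S}" using uv S by simp
    then have "(f u, f v) \<in> (\<lambda>(u, v). (f u, f v)) ` parcs F" unfolding R .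
    then obtain u' v' where *: "(u', v') \<in> parcs F" "f u = f u'" "f v = f v'" by auto
    then have "u' = u" "v' = v" using F inj uv by (auto dest: inj_onD)
    then show "(u, v) \<in> parcs F" using * by simp
  qed
  then show "induces F (parcs G) S" unfolding induces_def bij_betw_def using inj S by blast
next
  assume "induces F (parcs G) S"
  then obtain f where f: "inj_on f (pverts F)" "f ` pverts F = S"
    and R: "\<And>u v. u \<in> pverts F \<Longrightarrow> v \<in> pverts F \<Longrightarrow> (u, v) \<in> parcs F \<longleftrightarrow> (f u, f v) \<in> parcs G"
    unfolding induces_def bij_betw_def by blast
  define h where "h = \<lparr>iso_verts = f, iso_arcs = (\<lambda>(u, v). (f u, f v)), iso_head = snd, iso_tail = fst\<rparr>"
  have "pre_digraph.digraph_isomorphism (with_proj F) h"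
    using F f(1) unfolding pre_digraph.digraph_isomorphism_def h_def wf_digraph_def
    by (auto simp: inj_on_def)
  moreover have "with_proj G \<restriction> S = app_iso h (with_proj F)"
  proof (rule pre_digraph.equality)
    show "arcs (with_proj G \<restriction> S) = arcs (app_iso h (with_proj F))"
    proof (intro equalityI subsetI)
      fix e assume "e \<in> arcs (with_proj G \<restriction> S)"
      then have e: "(fst e, snd e) \<in> parcs G" "fst e \<in> f ` pverts F" "snd e \<in> f ` pverts F"
        using f by auto
      obtain u where u: "u \<in> pverts F" "fst e = f u" using e(2) by blast
      obtain v where v: "v \<in> pverts F" "snd e = f v" using e(3) by blast
      have "(u, v) \<in> parcs F" using R[OF u(1) v(1)] e(1) u v by simp
      moreover have "e = (f u, f v)" using u v by (auto intro: prod_eqI)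
      ultimately have "e \<in> (\<lambda>(u, v). (f u, f v)) ` parcs F" by (auto intro!: image_eqI[of _ _ "(u, v)"])
      then show "e \<in> arcs (app_iso h (with_proj F))" by (simp add: h_def)
    next
      fix e assume "e \<in> arcs (app_iso h (with_proj F))"
      then obtain u v where "(u, v) \<in> parcs F" "e = (f u, f v)" by (auto simp: h_def)
      moreover then have "u \<in> pverts F" "v \<in> pverts F" using F by auto
      ultimately show "e \<in> arcs (with_proj G \<restriction> S)" using R f(2) by auto
    qed
  qed (use f in \<open>auto simp: h_def\<close>)
  ultimately show "digraph_iso (with_proj F) (with_proj G \<restriction> S)"
    unfolding digraph_iso_def by blast
qed

lemma digraph_iso_whole_iff:
  assumes F: "parcs F \<subseteq> pverts F \<times> pverts F" and G: "parcs G \<subseteq> pverts G \<times> pverts G"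
  shows "digraph_iso (with_proj F) (with_proj G) \<longleftrightarrow> induces F (parcs G) (pverts G)"
proof -
  have "with_proj G \<restriction> pverts G = with_proj G"
    by (rule pre_digraph.equality) (use G in auto)
  then show ?thesis using digraph_iso_iff_induces[OF F, of G "pverts G"] by simp
qed

lemma induces_card: "induces F R S \<Longrightarrow> card S = card (pverts F)"
  unfolding induces_def by (auto dest!: bij_betw_same_card)

lemma induced_count_eq_card_copies:
  assumes "parcs F \<subseteq> pverts F \<times> pverts F"
  shows "induced_count F G = card (copies F (pverts G) (parcs G))"
  unfolding induced_count_def copies_def digraph_iso_iff_induces[OF assms]
  by (rule arg_cong[where f = card]) (auto dest: induces_card)

lemma finite_copies: "finite V \<Longrightarrow> finite (copies F V R)"
  unfolding copies_def by auto

lemma induces_cong: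
  assumes "\<And>x y. x \<in> S \<Longrightarrow> y \<in> S \<Longrightarrow> (x, y) \<in> R \<longleftrightarrow> (x, y) \<in> R'"
  shows "induces F R S \<longleftrightarrow> induces F R' S"
proof -
  have "f u \<in> S" if "bij_betw f (pverts F) S" "u \<in> pverts F" for f u
    using that by (auto simp: bij_betw_def)
  then show ?thesis unfolding induces_def using assms by metis
qed

lemma induces_image:
  assumes "inj_on \<phi> S"
  shows "induces F R (\<phi> ` S) \<longleftrightarrow> induces F (inv_image R \<phi>) S"
proof
  assume "induces F (inv_image R \<phi>) S"
  then obtain f where f: "bij_betw f (pverts F) S"
    "\<And>u v. u \<in> pverts F \<Longrightarrow> v \<in> pverts F \<Longrightarrow> (u, v) \<in> parcs F \<longleftrightarrow> (\<phi> (f u), \<phi> (f v)) \<in> R"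
    unfolding induces_def by auto
  have "bij_betw (\<phi> \<circ> f) (pverts F) (\<phi> ` S)"
    using f(1) assms by (intro bij_betw_trans[where B = S]) (auto simp: bij_betw_def)
  then show "induces F R (\<phi> ` S)" unfolding induces_def using f by (intro exI[of _ "\<phi> \<circ> f"]) auto
next
  assume "induces F R (\<phi> ` S)"
  then obtain f where f: "bij_betw f (pverts F) (\<phi> ` S)"
    "\<And>u v. u \<in> pverts F \<Longrightarrow> v \<in> pverts F \<Longrightarrow> (u, v) \<in> parcs F \<longleftrightarrow> (f u, f v) \<in> R"
    unfolding induces_def by auto
  define g where "g = the_inv_into S \<phi> \<circ> f"
  have b: "bij_betw g (pverts F) S"
    unfolding g_def using f(1) assms
    by (intro bij_betw_trans[where B = "\<phi> ` S"] bij_betw_the_inv_into) (auto simp: bij_betw_def)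
  have "\<phi> (g u) = f u" if "u \<in> pverts F" for u
    unfolding g_def using f(1) that assms by (auto simp: bij_betw_def intro!: f_the_inv_into_f)
  then show "induces F (inv_image R \<phi>) S"
    unfolding induces_def using f b by (intro exI[of _ g]) auto
qed

lemma induces_trans:
  assumes "induces F (parcs F') (pverts F')"
  shows "induces F' R S \<longleftrightarrow> induces F R S"
proof -
  obtain e where e: "bij_betw e (pverts F) (pverts F')"
    "\<And>u v. u \<in> pverts F \<Longrightarrow> v \<in> pverts F \<Longrightarrow> (u, v) \<in> parcs F \<longleftrightarrow> (e u, e v) \<in> parcs F'"
    using assms unfolding induces_def by auto
  have eF: "e u \<in> pverts F'" if "u \<in> pverts F" for u using e(1) that by (auto simp: bij_betw_def)
  show ?thesis
  proof
    assume "induces F' R S"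
    then obtain f where f: "bij_betw f (pverts F') S"
      "\<And>u v. u \<in> pverts F' \<Longrightarrow> v \<in> pverts F' \<Longrightarrow> (u, v) \<in> parcs F' \<longleftrightarrow> (f u, f v) \<in> R"
      unfolding induces_def by auto
    show "induces F R S"
      unfolding induces_def using bij_betw_trans[OF e(1) f(1)] f(2) e(2) eF
      by (intro exI[of _ "f \<circ> e"]) auto
  next
    assume "induces F R S"
    then obtain f where f: "bij_betw f (pverts F) S"
      "\<And>u v. u \<in> pverts F \<Longrightarrow> v \<in> pverts F \<Longrightarrow> (u, v) \<in> parcs F \<longleftrightarrow> (f u, f v) \<in> R"
      unfolding induces_def by auto
    define d where "d = the_inv_into (pverts F) e"
    have d: "bij_betw d (pverts F') (pverts F)" unfolding d_def by (rule bij_betw_the_inv_into[OF e(1)])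
    have dF: "d u \<in> pverts F" if "u \<in> pverts F'" for u using d that by (auto simp: bij_betw_def)
    have ed: "e (d u) = u" if "u \<in> pverts F'" for u
      unfolding d_def using e(1) that by (auto simp: bij_betw_def intro!: f_the_inv_into_f)
    have "(u, v) \<in> parcs F' \<longleftrightarrow> (f (d u), f (d v)) \<in> R" if "u \<in> pverts F'" "v \<in> pverts F'" for u v
      using f(2)[OF dF dF, OF that] e(2)[OF dF dF, OF that] ed that by simp
    then show "induces F' R S"
      unfolding induces_def using bij_betw_trans[OF d f(1)]
      by (intro exI[of _ "f \<circ> d"]) auto
  qed
qed

lemma pverts_K_partite: "pverts (K_partite as) = (SIGMA i:{..<length as}. {..<as ! i})"
  and parcs_K_partite: "(u, v) \<in> parcs (K_partite as) \<longleftrightarrow>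
    u \<in> pverts (K_partite as) \<and> v \<in> pverts (K_partite as) \<and> fst u \<noteq> fst v"
  by (auto simp: K_partite_def Let_def)

lemma K_partite_wf: "parcs (K_partite as) \<subseteq> pverts (K_partite as) \<times> pverts (K_partite as)"
  by (auto simp: K_partite_def Let_def)

lemma card_K_partite: "card (pverts (K_partite as)) = sum_list as"
  unfolding pverts_K_partite by (subst card_SigmaI) (auto simp: sum_list_sum_nth atLeast0LessThan)

text \<open>
  If adjacency on \<open>S\<close> means having different colours, the parts of an induced \<open>K_partite as\<close> are exactly the nonempty
  colour classes of \<open>S\<close>. So a copy is present if and only if the nonempty classes have the sizes \<open>as\<close>, in some order.
\<close>

lemma induces_K_partite_iff:
  fixes c :: "'b \<Rightarrow> nat"
  assumes S: "finite S" "\<And>u. u \<in> S \<Longrightarrow> c u < q" and as: "0 \<notin> set as"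
    and R: "\<And>u v. u \<in> S \<Longrightarrow> v \<in> S \<Longrightarrow> (u, v) \<in> R \<longleftrightarrow> c u \<noteq> c v"
  shows "induces (K_partite as) R S \<longleftrightarrow>
    mset (filter (\<lambda>d. d \<noteq> 0) (map (\<lambda>i. card {u \<in> S. c u = i}) [0..<q])) = mset as"
proof -
  define cc where "cc = (\<lambda>i. card {u \<in> S. c u = i})"
  define ls where "ls = filter (\<lambda>i. cc i \<noteq> 0) [0..<q]"
  have ls: "filter (\<lambda>d. d \<noteq> 0) (map cc [0..<q]) = map cc ls"
    by (simp add: ls_def filter_map o_def)
  have set_ls: "set ls = c ` S"
    using S by (auto simp: ls_def cc_def card_eq_0_iff)
  have "distinct ls" by (simp add: ls_def)
  have "induces (K_partite as) R S \<longleftrightarrow> mset (map cc ls) = mset as"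
  proof
    assume "induces (K_partite as) R S"
    then obtain f where f: "bij_betw f (pverts (K_partite as)) S"
      and fR: "\<And>u v. u \<in> pverts (K_partite as) \<Longrightarrow> v \<in> pverts (K_partite as) \<Longrightarrow>
          (u, v) \<in> parcs (K_partite as) \<longleftrightarrow> (f u, f v) \<in> R"
      unfolding induces_def by auto
    have fc: "c (f u) = c (f v) \<longleftrightarrow> fst u = fst v"
      if "u \<in> pverts (K_partite as)" "v \<in> pverts (K_partite as)" for u v
    proof -
      have "f u \<in> S" "f v \<in> S" using f that by (auto simp: bij_betw_def)
      then show ?thesis using fR[OF that] R that by (simp add: parcs_K_partite)
    qed
    define g where "g = (\<lambda>j. c (f (j, 0)))"
    have vert: "(j, 0) \<in> pverts (K_partite as)" if "j < length as" for j
    proof -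
      have "as ! j \<noteq> 0" using as nth_mem[OF that] by metis
      then show ?thesis using that by (simp add: pverts_K_partite)
    qed
    have ginj: "inj_on g {..<length as}"
      using fc vert by (auto simp: inj_on_def g_def)
    have cls: "{u \<in> S. c u = g j} = f ` ({j} \<times> {..<as ! j})" if "j < length as" for j
    proof -
      have "S = f ` pverts (K_partite as)" using f by (auto simp: bij_betw_def)
      then have "{u \<in> S. c u = g j} = f ` {v \<in> pverts (K_partite as). fst v = j}"
        using fc vert[OF that] by (force simp: g_def)
      also have "{v \<in> pverts (K_partite as). fst v = j} = {j} \<times> {..<as ! j}"
        using that by (auto simp: pverts_K_partite)
      finally show ?thesis .
    qed
    have cg: "cc (g j) = as ! j" if "j < length as" for j
    proof -
      have "inj_on f ({j} \<times> {..<as ! j})"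
        using f that by (auto simp: bij_betw_def pverts_K_partite elim!: inj_on_subset)
      then show ?thesis by (simp add: cc_def cls[OF that] card_image)
    qed
    have img: "c ` S = g ` {..<length as}"
    proof (intro equalityI subsetI)
      fix i assume "i \<in> c ` S"
      then obtain v where v: "v \<in> pverts (K_partite as)" "i = c (f v)"
        using f by (auto simp: bij_betw_def)
      then have "fst v < length as" by (auto simp: pverts_K_partite)
      then show "i \<in> g ` {..<length as}" using fc[OF v(1) vert] v by (auto simp: g_def)
    next
      fix i assume "i \<in> g ` {..<length as}"
      then show "i \<in> c ` S" using vert f by (auto simp: g_def bij_betw_def)
    qed
    have "mset (map cc ls) = image_mset cc (mset_set (set ls))"
      by (simp add: mset_set_set \<open>distinct ls\<close>)
    also have "\<dots> = image_mset (\<lambda>j. cc (g j)) (mset_set {..<length as})"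
      unfolding set_ls img image_mset_mset_set[OF ginj, symmetric]
      by (simp add: multiset.map_comp o_def)
    also have "\<dots> = image_mset (\<lambda>j. as ! j) (mset_set {..<length as})"
      by (rule image_mset_cong) (simp add: cg)
    also have "\<dots> = mset (map (\<lambda>j. as ! j) [0..<length as])"
      by (simp add: atLeast0LessThan)
    finally show "mset (map cc ls) = mset as" by (simp only: map_nth)
  next
    assume m: "mset (map cc ls) = mset as"
    then obtain p where p: "p permutes {..<length (map cc ls)}" "permute_list p (map cc ls) = as"
      using mset_eq_permutation[of as "map cc ls"] by metis
    have len: "length ls = length as" using m by (metis length_map mset_eq_length)
    define h where "h = (\<lambda>j. ls ! p j)"
    have pb: "bij_betw p {..<length as} {..<length as}"
      using permutes_imp_bij[OF p(1)] by (simp add: len)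
    have "bij_betw (\<lambda>j. ls ! j) {..<length as} (c ` S)"
      using bij_betw_nth[OF \<open>distinct ls\<close> _ set_ls[symmetric], of "{..<length as}"] len by simp
    then have hb: "bij_betw h {..<length as} (c ` S)"
      using bij_betw_trans[OF pb] unfolding h_def o_def by blast
    have hc: "as ! j = cc (h j)" if "j < length as" for j
    proof -
      have "p j < length as" using pb that by (auto simp: bij_betw_def)
      then show ?thesis using that p permute_list_nth[OF p(1), of j] by (simp add: len h_def)
    qed
    have "\<exists>e. bij_betw e {..<as ! j} {u \<in> S. c u = h j}" if "j < length as" for j
      using S(1) hc[OF that] by (intro finite_same_card_bij) (auto simp: cc_def)
    then obtain e where e: "\<And>j. j < length as \<Longrightarrow> bij_betw (e j) {..<as ! j} {u \<in> S. c u = h j}"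
      by metis
    define f where "f = (\<lambda>(j, l). e j l)"
    have fv: "f v \<in> S \<and> c (f v) = h (fst v)" if "v \<in> pverts (K_partite as)" for v
    proof -
      obtain j l where v: "v = (j, l)" "j < length as" "l < as ! j"
        using \<open>v \<in> pverts (K_partite as)\<close> by (auto simp: pverts_K_partite)
      then have "e j l \<in> e j ` {..<as ! j}" by simp
      also have "\<dots> = {u \<in> S. c u = h j}" using e[OF v(2)] by (simp add: bij_betw_def)
      finally show ?thesis by (simp add: f_def v(1))
    qed
    have hinj: "h i = h j \<longleftrightarrow> i = j" if "i < length as" "j < length as" for i j
      using hb that by (auto simp: bij_betw_def inj_on_def)
    have finj: "inj_on f (pverts (K_partite as))"
    proof (rule inj_onI)
      fix u v assume uv: "u \<in> pverts (K_partite as)" "v \<in> pverts (K_partite as)" "f u = f v"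
      then have "h (fst u) = h (fst v)" using fv by metis
      then have fs: "fst u = fst v" using hinj uv by (auto simp: pverts_K_partite)
      then have "e (fst u) (snd u) = e (fst u) (snd v)" using uv by (simp add: f_def case_prod_beta)
      moreover have "inj_on (e (fst u)) {..<as ! fst u}"
        using e uv by (auto simp: pverts_K_partite bij_betw_def)
      ultimately have "snd u = snd v" using uv fs by (auto simp: pverts_K_partite inj_on_def)
      then show "u = v" using fs by (simp add: prod_eq_iff)
    qed
    have "S \<subseteq> f ` pverts (K_partite as)"
    proof
      fix u assume u: "u \<in> S"
      then obtain j where j: "j < length as" "c u = h j" using hb by (auto simp: bij_betw_def)
      then have "u \<in> e j ` {..<as ! j}" using e[OF j(1)] u by (auto simp: bij_betw_def)
      then show "u \<in> f ` pverts (K_partite as)" using j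
        by (force simp: pverts_K_partite f_def)
    qed
    then have "bij_betw f (pverts (K_partite as)) S"
      using fv finj by (auto simp: bij_betw_def)
    moreover have "(u, v) \<in> parcs (K_partite as) \<longleftrightarrow> (f u, f v) \<in> R"
      if "u \<in> pverts (K_partite as)" "v \<in> pverts (K_partite as)" for u v
      using that fv[OF that(1)] fv[OF that(2)] R[of "f u" "f v"] hinj[of "fst u" "fst v"]
      by (auto simp: parcs_K_partite pverts_K_partite)
    ultimately show "induces (K_partite as) R S" unfolding induces_def by blast
  qed
  then show ?thesis using ls unfolding cc_def by simp
qed

section \<open>Symmetrization to complete partite graphs\<close>

definition simple_on :: "'b set \<Rightarrow> 'b rel \<Rightarrow> bool" where
  "simple_on V R \<longleftrightarrow> R \<subseteq> V \<times> V \<and> sym R \<and> irrefl R"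

definition clique_free :: "nat \<Rightarrow> 'b set \<Rightarrow> 'b rel \<Rightarrow> bool" where
  "clique_free k V R \<longleftrightarrow> \<not> (\<exists>K\<subseteq>V. card K = k \<and> (\<forall>x\<in>K. \<forall>y\<in>K. x \<noteq> y \<longrightarrow> (x, y) \<in> R))"

text \<open>
  The vertex \<open>u\<close> takes over the neighbourhood of \<open>v\<close>; irreflexivity of \<open>R\<close> makes the two vertices non-adjacent.
\<close>

definition clone :: "'b \<Rightarrow> 'b \<Rightarrow> 'b rel \<Rightarrow> 'b rel" where
  "clone u v R = inv_image R (id(u := v))"

lemma in_clone: "(x, y) \<in> clone u v R \<longleftrightarrow>
    ((if x = u then v else x), (if y = u then v else y)) \<in> R"
  by (auto simp: clone_def)

lemma simple_on_clone:
  assumes "simple_on V R" "u \<in> V"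
  shows "simple_on V (clone u v R)"
  using assms unfolding simple_on_def
  by (auto simp: in_clone sym_def irrefl_def split: if_splits)

lemma clique_free_clone:
  assumes "clique_free k V R" "irrefl R" "v \<in> V"
  shows "clique_free k V (clone u v R)"
  unfolding clique_free_def
proof
  assume "\<exists>K\<subseteq>V. card K = k \<and> (\<forall>x\<in>K. \<forall>y\<in>K. x \<noteq> y \<longrightarrow> (x, y) \<in> clone u v R)"
  then obtain K where K: "K \<subseteq> V" "card K = k" "\<And>x y. x \<in> K \<Longrightarrow> y \<in> K \<Longrightarrow> x \<noteq> y \<Longrightarrow> (x, y) \<in> clone u v R"
    by blast
  define \<phi> where "\<phi> = (\<lambda>x. if x = u then v else x)"
  have \<phi>: "(\<phi> x, \<phi> y) \<in> R" if "x \<in> K" "y \<in> K" "x \<noteq> y" for x y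
    using K(3)[OF that] by (simp add: in_clone \<phi>_def)
  have "inj_on \<phi> K"
    using \<phi> assms(2) by (auto simp: inj_on_def irrefl_def) metis
  then have "card (\<phi> ` K) = k" using K by (simp add: card_image)
  moreover have "\<phi> ` K \<subseteq> V" using K assms by (auto simp: \<phi>_def)
  moreover have "(x, y) \<in> R" if "x \<in> \<phi> ` K" "y \<in> \<phi> ` K" "x \<noteq> y" for x y
    using \<phi> that by auto
  ultimately show False using assms(1) unfolding clique_free_def by blast
qed

lemma induces_nonadjacent_twins:
  assumes F: "\<And>x y z. x \<in> pverts F \<Longrightarrow> y \<in> pverts F \<Longrightarrow> z \<in> pverts F \<Longrightarrow>
      (x, y) \<notin> parcs F \<Longrightarrow> (x, z) \<in> parcs F \<longleftrightarrow> (y, z) \<in> parcs F"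
    and "induces F R S" "u \<in> S" "v \<in> S" "w \<in> S" "(u, v) \<notin> R"
  shows "(u, w) \<in> R \<longleftrightarrow> (v, w) \<in> R"
proof -
  obtain f where f: "bij_betw f (pverts F) S"
    "\<And>u v. u \<in> pverts F \<Longrightarrow> v \<in> pverts F \<Longrightarrow> (u, v) \<in> parcs F \<longleftrightarrow> (f u, f v) \<in> R"
    using assms(2) unfolding induces_def by auto
  obtain x y z where "x \<in> pverts F" "y \<in> pverts F" "z \<in> pverts F" "u = f x" "v = f y" "w = f z"
    using f(1) assms(3-5) by (auto simp: bij_betw_def)
  then show ?thesis using F f(2) assms(6) by metis
qed

text \<open>
  Copies avoiding \<open>u\<close> are untouched, copies through both vertices survive because the two are twins inside such a copy,
  and exchanging \<open>u\<close> and \<open>v\<close> matches the new copies that contain only \<open>u\<close> with the old ones that contain only \<open>v\<close>.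
\<close>

lemma card_copies_clone:
  assumes F: "\<And>x y z. x \<in> pverts F \<Longrightarrow> y \<in> pverts F \<Longrightarrow> z \<in> pverts F \<Longrightarrow>
      (x, y) \<notin> parcs F \<Longrightarrow> (x, z) \<in> parcs F \<longleftrightarrow> (y, z) \<in> parcs F"
    and V: "finite V" "u \<in> V" "v \<in> V" and R: "simple_on V R" "(u, v) \<notin> R" "u \<noteq> v"
  shows "card (copies F V R) + card {S \<in> copies F V R. v \<in> S \<and> u \<notin> S}
    \<le> card (copies F V (clone u v R)) + card {S \<in> copies F V R. u \<in> S \<and> v \<notin> S}"
proof -
  \<comment> \<open>\<open>P R a b\<close>: the copies that contain \<open>u\<close> or not according to \<open>a\<close>, and \<open>v\<close> according to \<open>b\<close>.\<close>
  define P where "P = (\<lambda>R a b. {S \<in> copies F V R. (u \<in> S \<longleftrightarrow> a) \<and> (v \<in> S \<longleftrightarrow> b)})"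
  have split: "card (copies F V R) =
      card (P R True True) + card (P R True False) + card (P R False True) + card (P R False False)" for R
  proof -
    have "copies F V R = (P R True True \<union> P R True False) \<union> (P R False True \<union> P R False False)"
      by (auto simp: P_def)
    moreover have fin: "finite (P R a b)" for a b
      by (rule finite_subset[OF _ finite_copies[OF V(1)]]) (auto simp: P_def)
    have "card ((P R True True \<union> P R True False) \<union> (P R False True \<union> P R False False)) =
      (card (P R True True) + card (P R True False)) + (card (P R False True) + card (P R False False))"
      by (subst card_Un_disjoint; (subst card_Un_disjoint)?; (subst card_Un_disjoint)?)
         (auto simp: fin P_def finite_copies[OF V(1)])
    ultimately show ?thesis by simp
  qed
  let ?R' = "clone u v R"
  have P_noU: "P ?R' False b = P R False b" for b
  proof -
    have "induces F ?R' S \<longleftrightarrow> induces F R S" if "u \<notin> S" for S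
      using that by (intro induces_cong) (auto simp: in_clone)
    then show ?thesis by (auto simp: P_def copies_def)
  qed
  have both: "P R True True \<subseteq> P ?R' True True"
  proof
    fix S assume S: "S \<in> P R True True"
    then have i: "induces F R S" "u \<in> S" "v \<in> S" by (auto simp: P_def copies_def)
    have uw: "(u, w) \<in> R \<longleftrightarrow> (v, w) \<in> R" if "w \<in> S" for w
      by (rule induces_nonadjacent_twins[OF F i that R(2)])
    have wu: "(w, u) \<in> R \<longleftrightarrow> (w, v) \<in> R" if "w \<in> S" for w
      using uw[OF that] R(1) by (meson simple_on_def symD)
    have "induces F R S \<longleftrightarrow> induces F ?R' S"
      using uw wu i by (intro induces_cong) (auto simp: in_clone)
    then show "S \<in> P ?R' True True" using S i by (simp add: P_def copies_def)
  qed
  have "bij_betw (\<lambda>S. (id(u := v)) ` S) (P ?R' True False) (P R False True)"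
  proof (rule bij_betw_byWitness[where f' = "\<lambda>S. (id(v := u)) ` S"])
    show "\<forall>S\<in>P ?R' True False. (id(v := u)) ` (id(u := v)) ` S = S"
    proof
      fix S assume "S \<in> P ?R' True False"
      then have "v \<notin> S" by (simp add: P_def)
      then have "(id(v := u)) ((id(u := v)) x) = x" if "x \<in> S" for x using that by auto
      then show "(id(v := u)) ` (id(u := v)) ` S = S" by (simp only: image_image cong: image_cong) simp
    qed
    show "\<forall>S\<in>P R False True. (id(u := v)) ` (id(v := u)) ` S = S"
    proof
      fix S assume "S \<in> P R False True"
      then have "u \<notin> S" by (simp add: P_def)
      then have "(id(u := v)) ((id(v := u)) x) = x" if "x \<in> S" for x using that by auto
      then show "(id(u := v)) ` (id(v := u)) ` S = S" by (simp only: image_image cong: image_cong) simp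
    qed
    show "(`) (id(u := v)) ` P ?R' True False \<subseteq> P R False True"
    proof safe
      fix S assume S: "S \<in> P ?R' True False"
      then have inj: "inj_on (id(u := v)) S" by (auto simp: P_def inj_on_def)
      have "induces F R ((id(u := v)) ` S)"
        using S unfolding induces_image[OF inj] by (simp add: P_def copies_def clone_def)
      moreover have "(id(u := v)) ` S = insert v (S - {u})" using S by (auto simp: P_def image_iff)
      ultimately show "(id(u := v)) ` S \<in> P R False True"
        using S V R(3) by (auto simp: P_def copies_def)
    qed
    show "(`) (id(v := u)) ` P R False True \<subseteq> P ?R' True False"
    proof safe
      fix S assume S: "S \<in> P R False True"
      define T where "T = (id(v := u)) ` S"
      have T: "T = insert u (S - {v})" using S by (auto simp: P_def image_iff T_def)
      have inj: "inj_on (id(u := v)) T" using S by (auto simp: T P_def inj_on_def)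
      have "(id(u := v)) ` T = S" using S by (auto simp: T P_def image_iff)
      then have "induces F ?R' T"
        using S induces_image[OF inj, of F R] by (simp add: P_def copies_def clone_def)
      then have "T \<in> P ?R' True False"
        using S V R(3) by (auto simp: P_def copies_def T)
      then show "(id(v := u)) ` S \<in> P ?R' True False" by (simp add: T_def)
    qed
  qed
  then have "card (P ?R' True False) = card (P R False True)" by (rule bij_betw_same_card)
  moreover have "card (P R True True) \<le> card (P ?R' True True)"
    using both by (intro card_mono finite_subset[OF _ finite_copies[OF V(1), of F ?R']]) (auto simp: P_def)
  moreover have "{S \<in> copies F V R. v \<in> S \<and> u \<notin> S} = P R False True"
    "{S \<in> copies F V R. u \<in> S \<and> v \<notin> S} = P R True False" by (auto simp: P_def)
  ultimately show ?thesis using split[of R] split[of ?R'] by (simp add: P_noU)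
qed

definition twins :: "'b set \<Rightarrow> 'b rel \<Rightarrow> 'b rel" where
  "twins V R = {(x, y) \<in> V \<times> V. \<forall>z\<in>V. (x, z) \<in> R \<longleftrightarrow> (y, z) \<in> R}"

text \<open>
  Moving \<open>u\<close> out of its twin class destroys the pairs with its fewer than \<open>card (twins V R `` {u})\<close> former twins and creates
  pairs with the whole class of \<open>v\<close>, while twins other than \<open>u\<close> stay twins. The number of twin pairs thus breaks ties
  between graphs with equally many copies.
\<close>

lemma card_twins_clone:
  assumes V: "finite V" "u \<in> V" "v \<in> V" and R: "simple_on V R" "(u, v) \<notin> twins V R"
    and le: "card (twins V R `` {u}) \<le> card (twins V R `` {v})"
  shows "card (twins V R) < card (twins V (clone u v R))"
proof -
  define T0 where "T0 = {(x, y) \<in> twins V R. x \<noteq> u \<and> y \<noteq> u}"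
  define Cu where "Cu = twins V R `` {u} - {u}"
  define Cv where "Cv = twins V R `` {v}"
  have finT: "finite (twins V R)" for R
    by (rule finite_subset[of _ "V \<times> V"]) (auto simp: twins_def V)
  have fin: "finite T0" "finite Cu" "finite Cv"
    using V by (auto intro!: finite_subset[OF _ finT[of R]] simp: T0_def) (auto simp: Cu_def Cv_def twins_def)
  have uCv: "u \<notin> Cv" using R by (auto simp: Cv_def twins_def)
  have "card Cu < card Cv"
  proof -
    have "u \<in> twins V R `` {u}" using V by (auto simp: twins_def)
    moreover have "finite (twins V R `` {u})" using V by (auto simp: twins_def)
    ultimately have "card Cu < card (twins V R `` {u})" unfolding Cu_def by (intro psubset_card_mono) auto
    then show ?thesis using le by (simp add: Cv_def)
  qed
  have cnt: "card (T0 \<union> ({u} \<times> C \<union> (C \<times> {u} \<union> {(u, u)}))) = card T0 + (card C + (card C + 1))"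
    if "finite C" "u \<notin> C" for C
    using that fin by (subst card_Un_disjoint; (subst card_Un_disjoint)?; (subst card_Un_disjoint)?)
      (auto simp: T0_def card_cartesian_product)
  have "twins V R = T0 \<union> ({u} \<times> Cu \<union> (Cu \<times> {u} \<union> {(u, u)}))"
    using V by (auto simp: T0_def Cu_def twins_def)
  then have a: "card (twins V R) = card T0 + (card Cu + (card Cu + 1))"
    using cnt[of Cu] fin by (simp add: Cu_def)
  have sm: "(x, y) \<in> R \<longleftrightarrow> (y, x) \<in> R" for x y
    using R(1) by (auto simp: simple_on_def sym_def)
  have "T0 \<union> ({u} \<times> Cv \<union> (Cv \<times> {u} \<union> {(u, u)})) \<subseteq> twins V (clone u v R)"
    using V uCv sm by (auto simp: T0_def Cv_def twins_def in_clone) 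
  then have "card T0 + (card Cv + (card Cv + 1)) \<le> card (twins V (clone u v R))"
    using card_mono[OF finT] cnt[OF fin(3) uCv] by metis
  then show ?thesis using a \<open>card Cu < card Cv\<close> by linarith
qed

text \<open>
  Non-adjacency is then an equivalence relation, and representatives of distinct classes form a clique, which bounds the
  number of classes.
\<close>

lemma nonadjacent_twins_coloring:
  fixes R :: "'b rel"
  assumes V: "finite V" and R: "simple_on V R" "clique_free (Suc q) V R"
    and tw: "\<And>x y. x \<in> V \<Longrightarrow> y \<in> V \<Longrightarrow> (x, y) \<notin> R \<Longrightarrow> (x, y) \<in> twins V R"
  shows "\<exists>c :: 'b \<Rightarrow> nat. (\<forall>x\<in>V. c x < q) \<and> (\<forall>x\<in>V. \<forall>y\<in>V. (x, y) \<in> R \<longleftrightarrow> c x \<noteq> c y)"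
proof -
  define N where "N = (\<lambda>x. {y \<in> V. (x, y) \<notin> R})"
  have N: "(x, y) \<in> R \<longleftrightarrow> N x \<noteq> N y" if "x \<in> V" "y \<in> V" for x y
  proof
    assume "(x, y) \<in> R"
    moreover have "(y, y) \<notin> R" using R by (auto simp: simple_on_def irrefl_def)
    ultimately show "N x \<noteq> N y" using that by (auto simp: N_def)
  next
    assume "N x \<noteq> N y"
    then show "(x, y) \<in> R" using tw[OF that] by (auto simp: N_def twins_def)
  qed
  have "card (N ` V) \<le> q"
  proof (rule ccontr)
    assume "\<not> card (N ` V) \<le> q"
    then obtain P where P: "P \<subseteq> N ` V" "card P = Suc q"
      by (meson not_less_eq_eq obtain_subset_with_card_n)
    obtain K where K: "K \<subseteq> V" "inj_on N K" "N ` K = P"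
      using subset_image_inj[of P N V] P by metis
    have "card K = Suc q" using K P card_image by metis
    moreover have "(x, y) \<in> R" if "x \<in> K" "y \<in> K" "x \<noteq> y" for x y
      using N[of x y] K that by (auto simp: inj_on_def)
    ultimately show False using R(2) K unfolding clique_free_def by blast
  qed
  obtain h :: "'b set \<Rightarrow> nat" where h: "bij_betw h (N ` V) {0..<card (N ` V)}"
    using ex_bij_betw_finite_nat[of "N ` V"] V by blast
  have "h (N x) < q" if "x \<in> V" for x 
  proof -
    have "h (N x) \<in> {0..<card (N ` V)}" using h that by (auto simp: bij_betw_def)
    then show ?thesis using \<open>card (N ` V) \<le> q\<close> by simp
  qed
  moreover have "(x, y) \<in> R \<longleftrightarrow> h (N x) \<noteq> h (N y)" if "x \<in> V" "y \<in> V" for x y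
    using N[OF that] h that by (auto simp: bij_betw_def inj_on_def)
  ultimately show ?thesis by (intro exI[of _ "\<lambda>x. h (N x)"]) blast
qed

text \<open>
  Among all graphs on \<open>V\<close> without the clique, take one that maximizes the number of copies and, among those, the number of
  twin pairs. If two non-adjacent vertices were not twins, cloning one of them in the right direction would improve it.
\<close>

theorem symmetrization:
  fixes R :: "'b rel"
  assumes F: "\<And>x y z. x \<in> pverts F \<Longrightarrow> y \<in> pverts F \<Longrightarrow> z \<in> pverts F \<Longrightarrow>
      (x, y) \<notin> parcs F \<Longrightarrow> (x, z) \<in> parcs F \<longleftrightarrow> (y, z) \<in> parcs F"
    and V: "finite V" and R: "simple_on V R" "clique_free (Suc q) V R"
  shows "\<exists>R' (c :: 'b \<Rightarrow> nat). (\<forall>x\<in>V. c x < q) \<and> (\<forall>x\<in>V. \<forall>y\<in>V. (x, y) \<in> R' \<longleftrightarrow> c x \<noteq> c y) \<and>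
    card (copies F V R) \<le> card (copies F V R')"
proof -
  define G where "G = {R. simple_on V R \<and> clique_free (Suc q) V R}"
  have finT: "finite (twins V R)" for R
    by (rule finite_subset[of _ "V \<times> V"]) (auto simp: twins_def V)
  define m where "m = Suc (card (V \<times> V))"
  have tm: "card (twins V R) < m" for R
    unfolding m_def less_Suc_eq_le by (rule card_mono) (auto simp: V twins_def)
  \<comment> \<open>Lexicographic order: the factor \<open>m\<close> exceeds every possible number of twin pairs.\<close>
  define key where "key = (\<lambda>R. card (copies F V R) * m + card (twins V R))"
  have lex: "key R < key R'"
    if "card (copies F V R) < card (copies F V R') \<or>
      card (copies F V R) \<le> card (copies F V R') \<and> card (twins V R) < card (twins V R')" for R R'
  proof (cases "card (copies F V R) < card (copies F V R')")
    case True
    then have "Suc (card (copies F V R)) * m \<le> card (copies F V R') * m" by (intro mult_right_mono) auto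
    then show ?thesis using tm[of R] by (simp add: key_def)
  next
    case False
    then show ?thesis using that by (auto simp: key_def)
  qed
  have "finite G" by (rule finite_subset[of _ "Pow (V \<times> V)"]) (auto simp: G_def simple_on_def V)
  moreover have "R \<in> G" using R by (simp add: G_def)
  ultimately have "Max (key ` G) \<in> key ` G" by (intro Max_in) auto
  then obtain M where M: "M \<in> G" "key M = Max (key ` G)" by auto
  have max: "key R' \<le> key M" if "R' \<in> G" for R'
    using M that \<open>finite G\<close> by simp
  have sM: "simple_on V M" "clique_free (Suc q) V M" using M by (auto simp: G_def)
  have clone_G: "clone u v M \<in> G" if "u \<in> V" "v \<in> V" for u v
    using sM that simple_on_clone[of V M u v] clique_free_clone[of "Suc q" V M v u]
    by (auto simp: G_def simple_on_def)
  have tw: "(x, y) \<in> twins V M" if xy: "x \<in> V" "y \<in> V" "(x, y) \<notin> M" for x y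
  proof (rule ccontr)
    assume nt: "(x, y) \<notin> twins V M"
    have ntw: "(y, x) \<notin> twins V M" and nM: "(y, x) \<notin> M" and ne: "x \<noteq> y"
      using nt xy sM by (auto simp: twins_def simple_on_def sym_def)
    define n where "n = (\<lambda>u v. card {S \<in> copies F V M. u \<in> S \<and> v \<notin> S})"
    define t where "t = (\<lambda>u. card (twins V M `` {u}))"
    have bad: False if "u \<in> V" "v \<in> V" "(u, v) \<notin> M" "u \<noteq> v" "(u, v) \<notin> twins V M"
      "n u v < n v u \<or> n u v = n v u \<and> t u \<le> t v" for u v
    proof -
      have 1: "card (copies F V M) + n v u \<le> card (copies F V (clone u v M)) + n u v"
        unfolding n_def by (rule card_copies_clone[OF F V that(1,2) sM(1) that(3,4)])
      have 2: "t u \<le> t v \<Longrightarrow> card (twins V M) < card (twins V (clone u v M))"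
        unfolding t_def by (rule card_twins_clone[OF V that(1,2) sM(1) that(5)])
      have "key M < key (clone u v M)" using 1 2 that(6) by (intro lex) linarith
      then show False using max[OF clone_G[OF that(1,2)]] by simp
    qed
    have "(n x y < n y x \<or> n x y = n y x \<and> t x \<le> t y) \<or> (n y x < n x y \<or> n y x = n x y \<and> t y \<le> t x)"
      by linarith
    then show False using bad[of x y] bad[of y x] xy nt ntw nM ne by metis
  qed
  obtain c :: "'b \<Rightarrow> nat" where c: "\<forall>x\<in>V. c x < q" "\<forall>x\<in>V. \<forall>y\<in>V. (x, y) \<in> M \<longleftrightarrow> c x \<noteq> c y"
    using nonadjacent_twins_coloring[OF V sM tw] by blast
  moreover have "card (copies F V R) \<le> card (copies F V M)"
    using max[OF \<open>R \<in> G\<close>] lex[of M R] by (meson not_less)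
  ultimately show ?thesis by blast
qed

section \<open>Clique-free inducibility as the maximum of a polynomial\<close>

text \<open>
  The limit of \<open>(k choose a) / n ^ a\<close> when \<open>k / n\<close> tends to \<open>x\<close>.
\<close>

definition divided_power :: "real \<Rightarrow> nat \<Rightarrow> real" where
  "divided_power x a = x ^ a / fact a"

text \<open>
  The limiting relative sizes of \<open>q\<close> colour classes; empty classes are allowed.
\<close>

definition prob_vectors :: "nat \<Rightarrow> real list set" where
  "prob_vectors q = {xs. length xs = q \<and> (\<forall>x\<in>set xs. 0 \<le> x) \<and> sum_list xs = 1}"

lemma pair_graph_simple_on:
  assumes "pair_graph G"
  shows "simple_on (pverts G) (parcs G)" "finite (pverts G)"
proof -
  interpret pair_graph G by fact
  show "finite (pverts G)" by (rule pair_finite_verts)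
  have "sym (parcs G)" using pair_sym_arcs by (simp add: symmetric_def)
  moreover have "parcs G \<subseteq> pverts G \<times> pverts G"
    using arc_fst_in_verts arc_snd_in_verts by fastforce
  moreover have "irrefl (parcs G)" using pair_no_loops by (force simp: irrefl_def)
  ultimately show "simple_on (pverts G) (parcs G)" by (simp add: simple_on_def)
qed

lemma simple_on_pair_graph:
  assumes "simple_on V R" "finite V"
  shows "pair_graph \<lparr>pverts = V, parcs = R\<rparr>"
proof -
  have "finite R" using assms by (auto simp: simple_on_def intro: finite_subset[of R "V \<times> V"])
  then show ?thesis using assms
    by unfold_locales (auto simp: simple_on_def symmetric_def irrefl_def)
qed

lemma contains_clique_iff:
  assumes "pair_graph G"
  shows "contains_clique k G \<longleftrightarrow> \<not> clique_free k (pverts G) (parcs G)"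
proof
  assume "contains_clique k G"
  then obtain H where H: "subgraph H (with_proj G)" "complete_digraph k H"
    by (auto simp: contains_clique_def)
  have "(x, y) \<in> parcs G" if "x \<in> verts H" "y \<in> verts H" "x \<noteq> y" for x y
  proof -
    have "(x, y) \<in> arcs_ends H" using H(2) that by (auto simp: complete_digraph_def)
    then obtain e where "e \<in> arcs H" "(x, y) = (tail H e, head H e)"
      by (auto simp: arcs_ends_def arc_to_ends_def)
    then show ?thesis using H(1) by (auto simp: subgraph_def compatible_def)
  qed
  moreover have "verts H \<subseteq> pverts G" "card (verts H) = k"
    using H by (auto simp: subgraph_def complete_digraph_def)
  ultimately show "\<not> clique_free k (pverts G) (parcs G)" unfolding clique_free_def by blast
next
  assume "\<not> clique_free k (pverts G) (parcs G)"
  then obtain K where K: "K \<subseteq> pverts G" "card K = k" "\<And>x y. x \<in> K \<Longrightarrow> y \<in> K \<Longrightarrow> x \<noteq> y \<Longrightarrow> (x, y) \<in> parcs G"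
    unfolding clique_free_def by blast
  define H where "H = \<lparr>pverts = K, parcs = {(x, y). (x, y) \<in> K \<times> K \<and> x \<noteq> y}\<rparr>"
  have G: "simple_on (pverts G) (parcs G)" "finite (pverts G)" using pair_graph_simple_on[OF assms] .
  have "complete_digraph k (with_proj H)"
    unfolding complete_digraph_pair_def using K G finite_subset by (auto simp: H_def)
  moreover have "wf_digraph (with_proj H)" "wf_digraph (with_proj G)"
    using G by (auto simp: wf_digraph_def H_def simple_on_def)
  then have "subgraph (with_proj H) (with_proj G)"
    using K by (auto simp: subgraph_def compatible_def H_def)
  ultimately show "contains_clique k G" unfolding contains_clique_def by blast
qed

lemma K_partite_nonadjacent_twins:
  assumes "x \<in> pverts (K_partite as)" "y \<in> pverts (K_partite as)" "z \<in> pverts (K_partite as)"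
    "(x, y) \<notin> parcs (K_partite as)"
  shows "(x, z) \<in> parcs (K_partite as) \<longleftrightarrow> (y, z) \<in> parcs (K_partite as)"
  using assms by (auto simp: parcs_K_partite)

lemma card_copies_coloring:
  fixes c :: "'b \<Rightarrow> nat"
  assumes V: "finite V" "\<And>v. v \<in> V \<Longrightarrow> c v < q" and as: "0 \<notin> set as"
    and R: "\<And>u v. u \<in> V \<Longrightarrow> v \<in> V \<Longrightarrow> (u, v) \<in> R \<longleftrightarrow> c u \<noteq> c v"
  shows "card (copies (K_partite as) V R) =
    profile_sum (\<lambda>k a. k choose a) (mset as) (map (\<lambda>i. card {v \<in> V. c v = i}) [0..<q])"
proof -
  define Vs where "Vs = map (\<lambda>i. {v \<in> V. c v = i}) [0..<q]"
  have U: "\<Union>(set Vs) = V" using V by (auto simp: Vs_def)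
  have "copies (K_partite as) V R =
      {S. S \<subseteq> \<Union>(set Vs) \<and> mset (filter (\<lambda>d. d \<noteq> 0) (map (\<lambda>X. card (S \<inter> X)) Vs)) = mset as}"
  proof -
    have "induces (K_partite as) R S \<longleftrightarrow>
        mset (filter (\<lambda>d. d \<noteq> 0) (map (\<lambda>X. card (S \<inter> X)) Vs)) = mset as" if "S \<subseteq> V" for S
    proof -
      have "S \<inter> {v \<in> V. c v = i} = {u \<in> S. c u = i}" for i using that by auto
      then have "map (\<lambda>X. card (S \<inter> X)) Vs = map (\<lambda>i. card {u \<in> S. c u = i}) [0..<q]"
        by (simp add: Vs_def)
      moreover have "finite S" using that V finite_subset by blast
      ultimately show ?thesis
        using induces_K_partite_iff[of S c q as R] that V as R by (auto simp: subset_iff)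
    qed
    then show ?thesis unfolding U copies_def by blast
  qed
  also have "card \<dots> = profile_sum (\<lambda>X a. card X choose a) (mset as) Vs"
  proof (rule card_sets_with_profile)
    show "sorted_wrt (\<lambda>X Y. X \<inter> Y = {}) Vs"
      unfolding Vs_def sorted_wrt_map by (rule sorted_wrt_mono_rel[OF _ sorted_wrt_upt]) auto
  qed (use V as in \<open>auto simp: Vs_def\<close>)
  also have "\<dots> = profile_sum (\<lambda>k a. k choose a) (mset as) (map (\<lambda>i. card {v \<in> V. c v = i}) [0..<q])"
    unfolding Vs_def profile_sum_map ..
  finally show ?thesis .
qed

lemma sum_color_classes:
  fixes c :: "'b \<Rightarrow> nat"
  assumes "finite V" "\<And>v. v \<in> V \<Longrightarrow> c v < q"
  shows "sum_list (map (\<lambda>i. card {v \<in> V. c v = i}) [0..<q]) = card V"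
proof -
  have "sum_list (map (\<lambda>i. card {v \<in> V. c v = i}) [0..<q]) = (\<Sum>i\<in>{0..<q}. card {v \<in> V. c v = i})"
    by (simp add: interv_sum_list_conv_sum_set_nat)
  also have "\<dots> = card (\<Union>i\<in>{0..<q}. {v \<in> V. c v = i})"
    using assms by (subst card_UN_disjoint) auto
  also have "(\<Union>i\<in>{0..<q}. {v \<in> V. c v = i}) = V" using assms by auto
  finally show ?thesis .
qed

lemma induced_count_le_profile:
  fixes G :: "nat pair_pre_digraph"
  assumes G: "pair_graph G" "\<not> contains_clique (Suc q) G" and as: "0 \<notin> set as"
  shows "\<exists>ns. length ns = q \<and> sum_list ns = card (pverts G) \<and>
    induced_count (K_partite as) G \<le> profile_sum (\<lambda>k a. k choose a) (mset as) ns"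
proof -
  note sG = pair_graph_simple_on[OF G(1)]
  have cf: "clique_free (Suc q) (pverts G) (parcs G)" using G contains_clique_iff by blast
  have "\<exists>R' (c :: nat \<Rightarrow> nat). (\<forall>x\<in>pverts G. c x < q) \<and>
      (\<forall>x\<in>pverts G. \<forall>y\<in>pverts G. (x, y) \<in> R' \<longleftrightarrow> c x \<noteq> c y) \<and>
      card (copies (K_partite as) (pverts G) (parcs G)) \<le> card (copies (K_partite as) (pverts G) R')"
    by (rule symmetrization[OF _ sG(2,1) cf]) (rule K_partite_nonadjacent_twins)
  then obtain R' and c :: "nat \<Rightarrow> nat" where c: "\<forall>x\<in>pverts G. c x < q"
    "\<forall>x\<in>pverts G. \<forall>y\<in>pverts G. (x, y) \<in> R' \<longleftrightarrow> c x \<noteq> c y"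
    "card (copies (K_partite as) (pverts G) (parcs G)) \<le> card (copies (K_partite as) (pverts G) R')"
    by blast
  let ?ns = "map (\<lambda>i. card {v \<in> pverts G. c v = i}) [0..<q]"
  have "induced_count (K_partite as) G \<le> profile_sum (\<lambda>k a. k choose a) (mset as) ?ns"
    using c(3) card_copies_coloring[OF sG(2) _ as, of c q R'] c(1,2)
    by (simp add: induced_count_eq_card_copies[OF K_partite_wf])
  moreover have "sum_list ?ns = card (pverts G)" using sum_color_classes[OF sG(2)] c(1) by blast
  ultimately show ?thesis by (intro exI[of _ ?ns]) simp
qed

lemma induced_count_eq_profile:
  assumes as: "0 \<notin> set as"
  shows "\<exists>G :: nat pair_pre_digraph. pair_graph G \<and> card (pverts G) = sum_list ns \<and>
    \<not> contains_clique (Suc (length ns)) G \<and>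
    induced_count (K_partite as) G = profile_sum (\<lambda>k a. k choose a) (mset as) ns"
proof -
  define q where "q = length ns"
  define V where "V = prod_encode ` (SIGMA i:{..<q}. {..<ns ! i})"
  define c where "c = fst \<circ> prod_decode"
  define R where "R = {(u, v) \<in> V \<times> V. c u \<noteq> c v}"
  define G where "G = \<lparr>pverts = V, parcs = R\<rparr>"
  have fin: "finite V" by (auto simp: V_def)
  have cV: "c v < q" if "v \<in> V" for v using that by (auto simp: V_def c_def)
  have "{v \<in> V. c v = i} = prod_encode ` ({i} \<times> {..<ns ! i})" if "i < q" for i
    using that by (auto simp: V_def c_def)
  then have "card {v \<in> V. c v = i} = ns ! i" if "i < q" for i
    using that by (simp add: card_image[OF inj_prod_encode])
  then have ns: "map (\<lambda>i. card {v \<in> V. c v = i}) [0..<q] = ns"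
    by (auto simp: q_def intro!: nth_equalityI)
  have pg: "pair_graph G" unfolding G_def
    by (rule simple_on_pair_graph[OF _ fin]) (auto simp: simple_on_def R_def sym_def irrefl_def)
  have "clique_free (Suc q) V R"
    unfolding clique_free_def
  proof
    assume "\<exists>K\<subseteq>V. card K = Suc q \<and> (\<forall>x\<in>K. \<forall>y\<in>K. x \<noteq> y \<longrightarrow> (x, y) \<in> R)"
    then obtain K where K: "K \<subseteq> V" "card K = Suc q" "\<forall>x\<in>K. \<forall>y\<in>K. x \<noteq> y \<longrightarrow> (x, y) \<in> R" by blast
    then have "inj_on c K" by (auto simp: inj_on_def R_def)
    moreover have "c ` K \<subseteq> {..<q}" using K cV by auto
    ultimately have "card K \<le> q" using card_inj_on_le[of c K "{..<q}"] by simp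
    then show False using K by simp
  qed
  then have "\<not> contains_clique (Suc (length ns)) G"
    using contains_clique_iff[OF pg] by (simp add: G_def q_def)
  moreover have "induced_count (K_partite as) G = profile_sum (\<lambda>k a. k choose a) (mset as) ns"
    using card_copies_coloring[OF fin cV as, where R = R]
    by (simp add: induced_count_eq_card_copies[OF K_partite_wf] G_def ns R_def)
  moreover have "card (pverts G) = sum_list ns"
    using sum_color_classes[OF fin, of c q] cV ns by (simp add: G_def)
  ultimately show ?thesis using pg by blast
qed

lemma finite_densities:
  "finite {induced_density F G | G :: nat pair_pre_digraph. pair_graph G \<and> card (pverts G) = n \<and> P G}"
proof (rule finite_subset)
  show "{induced_density F G | G :: nat pair_pre_digraph. pair_graph G \<and> card (pverts G) = n \<and> P G}
    \<subseteq> (\<lambda>c. real c / real (n choose card (pverts F))) ` {..2 ^ n}"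
  proof safe
    fix G :: "nat pair_pre_digraph" assume G: "pair_graph G" "n = card (pverts G)"
    have fin: "finite (pverts G)" using pair_graph_simple_on G by blast
    have "induced_count F G \<le> card (Pow (pverts G))"
      unfolding induced_count_def by (rule card_mono) (auto simp: fin)
    then have "induced_count F G \<le> 2 ^ card (pverts G)" using fin by (simp add: card_Pow)
    then show "induced_density F G \<in> (\<lambda>c. real c / real (card (pverts G) choose card (pverts F))) ` {..2 ^ card (pverts G)}"
      unfolding induced_density_def by auto
  qed
qed simp

lemma max_density_clique_free_ge_profile:
  assumes "0 \<notin> set as" "length ns = q" "sum_list ns = n"
  shows "real (profile_sum (\<lambda>k a. k choose a) (mset as) ns) / real (n choose sum_list as)
    \<le> max_density_clique_free (Suc q) (K_partite as) n"
proof -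
  obtain G :: "nat pair_pre_digraph" where G: "pair_graph G" "card (pverts G) = n"
    "\<not> contains_clique (Suc q) G"
    "induced_count (K_partite as) G = profile_sum (\<lambda>k a. k choose a) (mset as) ns"
    using induced_count_eq_profile[OF assms(1), of ns] assms by auto
  have "induced_density (K_partite as) G \<le> max_density_clique_free (Suc q) (K_partite as) n"
    unfolding max_density_clique_free_def
    by (rule Max_ge[OF finite_densities]) (use G in blast)
  then show ?thesis by (simp add: induced_density_def G card_K_partite)
qed

lemma max_density_clique_free_le_profile:
  assumes "0 \<notin> set as" "1 \<le> q"
    and le: "\<And>ns. length ns = q \<Longrightarrow> sum_list ns = n \<Longrightarrow>
      real (profile_sum (\<lambda>k a. k choose a) (mset as) ns) \<le> B"
  shows "max_density_clique_free (Suc q) (K_partite as) n \<le> B / real (n choose sum_list as)"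
  unfolding max_density_clique_free_def
proof (rule Max.boundedI[OF finite_densities])
  let ?ns = "n # replicate (q - 1) 0"
  have "sum_list ?ns = n" "length ?ns = q" using assms by (auto simp: sum_list_replicate)
  then obtain G :: "nat pair_pre_digraph" where "pair_graph G" "card (pverts G) = n"
    "\<not> contains_clique (Suc q) G"
    using induced_count_eq_profile[OF assms(1), of ?ns] by auto
  then show "{induced_density (K_partite as) G |G :: nat pair_pre_digraph.
      pair_graph G \<and> card (pverts G) = n \<and> \<not> contains_clique (Suc q) G} \<noteq> {}" by blast
next
  fix d assume "d \<in> {induced_density (K_partite as) G |G :: nat pair_pre_digraph.
      pair_graph G \<and> card (pverts G) = n \<and> \<not> contains_clique (Suc q) G}"
  then obtain G :: "nat pair_pre_digraph" where G: "d = induced_density (K_partite as) G"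
    "pair_graph G" "card (pverts G) = n" "\<not> contains_clique (Suc q) G" by blast
  obtain ns where ns: "length ns = q" "sum_list ns = n"
    "induced_count (K_partite as) G \<le> profile_sum (\<lambda>k a. k choose a) (mset as) ns"
    using induced_count_le_profile[OF G(2,4) assms(1)] G(3) by auto
  have "real (induced_count (K_partite as) G) \<le> B" using ns(3) le[OF ns(1,2)] by linarith
  then show "d \<le> B / real (n choose sum_list as)"
    by (simp add: G(1,3) induced_density_def card_K_partite divide_right_mono)
qed

text \<open>
  A graph on \<open>n\<close> vertices has no clique of \<open>n + 1\<close> vertices, so the unrestricted problem is an instance of the
  clique-free one, with a forbidden clique that grows with \<open>n\<close>.
\<close>

lemma max_density_eq_clique_free:
  "max_density F n = max_density_clique_free (Suc n) F n"
proof -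
  have "\<not> contains_clique (Suc n) G" if G: "pair_graph G" "card (pverts G) = n" for G :: "nat pair_pre_digraph"
  proof -
    have "card K \<noteq> Suc n" if "K \<subseteq> pverts G" for K
      using card_mono[OF _ that] pair_graph_simple_on(2)[OF G(1)] G(2) by auto
    then show ?thesis unfolding contains_clique_iff[OF G(1)] clique_free_def by blast
  qed
  then show ?thesis unfolding max_density_def max_density_clique_free_def by metis
qed

lemma divided_power_nonneg: "0 \<le> x \<Longrightarrow> 0 \<le> divided_power x a"
  by (simp add: divided_power_def)

lemma profile_sum_choose_le:
  assumes "0 < n"
  shows "real (profile_sum (\<lambda>k a. k choose a) A ns)
    \<le> real n ^ sum_mset A * profile_sum divided_power A (map (\<lambda>k. real k / real n) ns)"
proof -
  have "real (profile_sum (\<lambda>k a. k choose a) A ns) = profile_sum (\<lambda>k a. real (k choose a)) A ns"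
    by (rule of_nat_profile_sum)
  also have "\<dots> \<le> profile_sum (\<lambda>k a. real n ^ a * divided_power (real k / real n) a) A ns"
  proof (rule profile_sum_mono, rule conjI)
    fix k a
    have "(k choose a) * fact a \<le> k ^ a" by (rule binomial_fact_pow)
    then have "real ((k choose a) * fact a) \<le> real (k ^ a)" by (simp only: of_nat_le_iff)
    then show "real (k choose a) \<le> real n ^ a * divided_power (real k / real n) a"
      using assms by (simp add: divided_power_def power_divide field_simps)
  qed simp
  also have "\<dots> = real n ^ sum_mset A * profile_sum (\<lambda>k. divided_power (real k / real n)) A ns"
    by (rule profile_sum_scale)
  finally show ?thesis by (simp add: profile_sum_map)
qed

lemma normalized_prob_vector:
  assumes "0 < n" "sum_list ns = n" "length ns = q"
  shows "map (\<lambda>k. real k / real n) ns \<in> prob_vectors q"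
proof -
  have "sum_list (map (\<lambda>k. real k / real n) ns) = real (sum_list ns) / real n" for ns :: "nat list"
    by (induction ns) (auto simp: add_divide_distrib)
  then show ?thesis using assms by (auto simp: prob_vectors_def)
qed

lemma tendsto_choose:
  assumes "(\<lambda>n. real (f n) / real n) \<longlonglongrightarrow> x"
  shows "(\<lambda>n. real (f n choose a) / real n ^ a) \<longlonglongrightarrow> divided_power x a"
proof -
  have "(\<lambda>n. (\<Prod>i = 0..<a. (real (f n) / real n - real i / real n)) / fact a) \<longlonglongrightarrow>
      (\<Prod>i = 0..<a. (x - 0)) / fact a"
    by (intro tendsto_divide tendsto_prod tendsto_diff assms lim_const_over_n tendsto_const) simp
  moreover have "(\<Prod>i = 0..<a. (real (f n) / real n - real i / real n)) / fact a = real (f n choose a) / real n ^ a" for n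
  proof -
    have "real (f n choose a) = (\<Prod>i = 0..<a. real (f n) - real i) / fact a"
      by (simp add: binomial_gbinomial gbinomial_prod_rev)
    then show ?thesis
      by (simp add: diff_divide_distrib[symmetric] prod_dividef)
  qed
  ultimately show ?thesis by (simp add: divided_power_def)
qed

lemma tendsto_choose_normalized:
  "(\<lambda>n. real (n choose m) / real n ^ m) \<longlonglongrightarrow> 1 / fact m"
proof -
  have "(\<lambda>n. real n / real n) \<longlonglongrightarrow> 1"
    by (rule tendsto_eventually) (auto intro: eventually_sequentiallyI[of 1])
  from tendsto_choose[OF this] show ?thesis by (simp add: divided_power_def)
qed

lemma tendsto_floor_mult:
  assumes "0 \<le> x"
  shows "(\<lambda>n. real (nat \<lfloor>x * real n\<rfloor>) / real n) \<longlonglongrightarrow> x"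
proof (rule tendsto_sandwich)
  show "\<forall>\<^sub>F n in sequentially. x - 1 / real n \<le> real (nat \<lfloor>x * real n\<rfloor>) / real n"
  proof (rule eventually_sequentiallyI[of 1])
    fix n :: nat assume n: "1 \<le> n"
    have "x * real n - 1 \<le> real (nat \<lfloor>x * real n\<rfloor>)" by linarith
    then have "(x * real n - 1) / real n \<le> real (nat \<lfloor>x * real n\<rfloor>) / real n"
      by (rule divide_right_mono) simp
    then show "x - 1 / real n \<le> real (nat \<lfloor>x * real n\<rfloor>) / real n"
      using n by (simp add: diff_divide_distrib)
  qed
  show "\<forall>\<^sub>F n in sequentially. real (nat \<lfloor>x * real n\<rfloor>) / real n \<le> x"
  proof (rule eventually_sequentiallyI[of 1])
    fix n :: nat assume n: "1 \<le> n"
    have "real (nat \<lfloor>x * real n\<rfloor>) \<le> x * real n" using assms by (simp add: of_nat_nat)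
    then show "real (nat \<lfloor>x * real n\<rfloor>) / real n \<le> x" using n by (simp add: divide_le_eq)
  qed
  show "(\<lambda>n. x - 1 / real n) \<longlonglongrightarrow> x"
    using tendsto_diff[OF tendsto_const lim_const_over_n[of 1], of x] by simp
qed simp

text \<open>
  Rounding all entries but the first down and giving the remaining vertices to the first class produces class
  sizes with sum exactly \<open>n\<close>.
\<close>

lemma exists_proportional_sizes:
  assumes xs: "xs \<in> prob_vectors q" "1 \<le> q"
  shows "\<exists>fs :: (nat \<Rightarrow> nat) list. length fs = q \<and> (\<forall>n. sum_list (map (\<lambda>f. f n) fs) = n) \<and>
    (\<forall>(f, x)\<in>set (zip fs xs). (\<lambda>n. real (f n) / real n) \<longlonglongrightarrow> x)"
proof -
  obtain y ys where y: "xs = y # ys" using xs by (cases xs) (auto simp: prob_vectors_def)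
  have nn: "0 \<le> y" "\<And>x. x \<in> set ys \<Longrightarrow> 0 \<le> x" "y = 1 - sum_list ys" "Suc (length ys) = q"
    using xs by (auto simp: prob_vectors_def y)
  define g where "g = (\<lambda>x n. nat \<lfloor>x * real n\<rfloor>)"
  define h where "h = (\<lambda>n. \<Sum>x\<leftarrow>ys. g x n)"
  have g: "(\<lambda>n. real (g x n) / real n) \<longlonglongrightarrow> x" if "x \<in> set ys" for x
    unfolding g_def using tendsto_floor_mult nn that by blast
  have hle: "h n \<le> n" for n
  proof -
    have "real (\<Sum>x\<leftarrow>zs. g x n) \<le> sum_list zs * real n" if "\<And>x. x \<in> set zs \<Longrightarrow> 0 \<le> x" for zs
      using that
    proof (induction zs)
      case (Cons z zs)
      have "real (g z n) \<le> z * real n" unfolding g_def using Cons.prems by (simp add: of_nat_nat)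
      moreover have "real (\<Sum>x\<leftarrow>zs. g x n) \<le> sum_list zs * real n" using Cons by simp
      ultimately show ?case by (simp add: algebra_simps)
    qed simp
    from this[of ys] have "real (h n) \<le> sum_list ys * real n" using nn by (simp add: h_def)
    also have "\<dots> \<le> 1 * real n" using nn by (intro mult_right_mono) auto
    finally show ?thesis by simp
  qed
  have hlim: "(\<lambda>n. real (h n) / real n) \<longlonglongrightarrow> sum_list ys"
  proof -
    have "(\<lambda>n. real (\<Sum>x\<leftarrow>zs. g x n) / real n) \<longlonglongrightarrow> sum_list zs" if "set zs \<subseteq> set ys" for zs
      using that by (induction zs) (auto simp: add_divide_distrib intro!: tendsto_add g)
    then show ?thesis by (simp add: h_def)
  qed
  have "(\<lambda>n. 1 - real (h n) / real n) \<longlonglongrightarrow> 1 - sum_list ys"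
    by (intro tendsto_diff tendsto_const hlim)
  moreover have "\<forall>\<^sub>F n in sequentially. 1 - real (h n) / real n = real (n - h n) / real n"
    by (rule eventually_sequentiallyI[of 1]) (simp add: hle of_nat_diff field_simps)
  ultimately have y0: "(\<lambda>n. real (n - h n) / real n) \<longlonglongrightarrow> y"
    unfolding nn(3) by (rule Lim_transform_eventually)
  let ?fs = "(\<lambda>n. n - h n) # map g ys"
  have "sum_list (map (\<lambda>f. f n) ?fs) = n" for n
    using hle[of n] by (simp add: h_def o_def)
  moreover have "(\<lambda>n. real (f n) / real n) \<longlonglongrightarrow> x" if "(f, x) \<in> set (zip ?fs xs)" for f x
    using that y0 g by (auto simp: y zip_map1 zip_same)
  ultimately show ?thesis using nn by (intro exI[of _ ?fs]) auto
qed

text \<open>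
  The upper bound is \<open>(k choose a) \<le> k ^ a / a!\<close> applied in every class together with homogeneity; the lower bound comes from
  complete partite graphs whose class sizes are proportional to a maximizing vector.
\<close>

theorem max_density_clique_free_limit:
  assumes as: "0 \<notin> set as" and q: "1 \<le> q"
    and xs: "xs \<in> prob_vectors q" "\<And>ys. ys \<in> prob_vectors q \<Longrightarrow> profile_sum divided_power (mset as) ys \<le> profile_sum divided_power (mset as) xs"
  shows "max_density_clique_free (Suc q) (K_partite as) \<longlonglongrightarrow> fact (sum_list as) * profile_sum divided_power (mset as) xs"
proof -
  define m where "m = sum_list as"
  define M where "M = profile_sum divided_power (mset as) xs"
  have msum: "sum_mset (mset as) = m" by (simp add: m_def sum_mset_sum_list)
  obtain fs :: "(nat \<Rightarrow> nat) list" where fs: "length fs = q" "\<And>n. sum_list (map (\<lambda>f. f n) fs) = n"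
    "\<And>f x. (f, x) \<in> set (zip fs xs) \<Longrightarrow> (\<lambda>n. real (f n) / real n) \<longlonglongrightarrow> x"
    using exists_proportional_sizes[OF xs(1) q] by blast
  define low where "low = (\<lambda>n. profile_sum (\<lambda>k a. k choose a) (mset as) (map (\<lambda>f. f n) fs))"
  have lowlim: "(\<lambda>n. real (low n) / real n ^ m) \<longlonglongrightarrow> M"
  proof -
    have len: "length xs = q" using xs by (simp add: prob_vectors_def)
    have "(\<lambda>n. profile_sum (\<lambda>p a. real (fst p n choose a) / real n ^ a) (mset as) (zip fs xs))
        \<longlonglongrightarrow> profile_sum (\<lambda>p. divided_power (snd p)) (mset as) (zip fs xs)"
      by (rule tendsto_profile_sum) (use fs(3) in \<open>auto intro!: tendsto_choose\<close>)
    also have "profile_sum (\<lambda>p. divided_power (snd p)) (mset as) (zip fs xs) = M"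
      using profile_sum_map[of divided_power "mset as" snd "zip fs xs"] len fs(1)
      by (simp add: M_def)
    finally have "(\<lambda>n. profile_sum (\<lambda>p a. real (fst p n choose a) / real n ^ a) (mset as) (zip fs xs)) \<longlonglongrightarrow> M" .
    moreover have "\<forall>\<^sub>F n in sequentially.
      profile_sum (\<lambda>p a. real (fst p n choose a) / real n ^ a) (mset as) (zip fs xs) = real (low n) / real n ^ m"
    proof (rule eventually_sequentiallyI[of 1])
      fix n :: nat assume "1 \<le> n"
      have "profile_sum (\<lambda>p a. real (fst p n choose a) / real n ^ a) (mset as) (zip fs xs)
          = profile_sum (\<lambda>f a. real (f n choose a) / real n ^ a) (mset as) fs"
        using profile_sum_map[of "\<lambda>f a. real (f n choose a) / real n ^ a" "mset as" fst "zip fs xs"] len fs(1)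
        by simp
      also have "\<dots> = profile_sum (\<lambda>f a. (1 / real n) ^ a * real (f n choose a)) (mset as) fs"
        by (rule profile_sum_cong) (simp add: power_one_over)
      also have "\<dots> = (1 / real n) ^ m * profile_sum (\<lambda>f a. real (f n choose a)) (mset as) fs"
        unfolding msum[symmetric] by (rule profile_sum_scale)
      also have "profile_sum (\<lambda>f a. real (f n choose a)) (mset as) fs = real (low n)"
        unfolding low_def of_nat_profile_sum profile_sum_map ..
      finally show "profile_sum (\<lambda>p a. real (fst p n choose a) / real n ^ a) (mset as) (zip fs xs)
          = real (low n) / real n ^ m"
        by (simp add: power_one_over)
    qed
    ultimately show ?thesis by (rule Lim_transform_eventually)
  qed
  have nm: "(\<lambda>n. real (n choose m) / real n ^ m) \<longlonglongrightarrow> 1 / fact m" by (rule tendsto_choose_normalized)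
  have ne: "1 / fact m \<noteq> (0::real)" by simp
  show ?thesis
  proof (rule tendsto_sandwich)
    show "\<forall>\<^sub>F n in sequentially. (real (low n) / real n ^ m) / (real (n choose m) / real n ^ m)
        \<le> max_density_clique_free (Suc q) (K_partite as) n"
    proof (rule eventually_sequentiallyI[of 1])
      fix n :: nat assume "1 \<le> n"
      then have eq: "(real (low n) / real n ^ m) / (real (n choose m) / real n ^ m) = real (low n) / real (n choose m)"
        by simp
      show "(real (low n) / real n ^ m) / (real (n choose m) / real n ^ m)
          \<le> max_density_clique_free (Suc q) (K_partite as) n"
        unfolding eq using max_density_clique_free_ge_profile[OF as, of "map (\<lambda>f. f n) fs" q n] fs by (simp add: low_def m_def)
    qed
    show "\<forall>\<^sub>F n in sequentially. max_density_clique_free (Suc q) (K_partite as) n \<le> M / (real (n choose m) / real n ^ m)"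
    proof (rule eventually_sequentiallyI[of 1])
      fix n :: nat assume n: "1 \<le> n"
      have "max_density_clique_free (Suc q) (K_partite as) n \<le> (real n ^ m * M) / real (n choose sum_list as)"
      proof (rule max_density_clique_free_le_profile[OF as q])
        fix ns assume ns: "length ns = q" "sum_list ns = n"
        have "real (profile_sum (\<lambda>k a. k choose a) (mset as) ns)
            \<le> real n ^ m * profile_sum divided_power (mset as) (map (\<lambda>k. real k / real n) ns)"
          using profile_sum_choose_le[of n "mset as" ns] n by (simp add: msum)
        also have "\<dots> \<le> real n ^ m * M"
          unfolding M_def using n ns by (intro mult_left_mono xs(2) normalized_prob_vector) auto
        finally show "real (profile_sum (\<lambda>k a. k choose a) (mset as) ns) \<le> real n ^ m * M" .
      qed
      then show "max_density_clique_free (Suc q) (K_partite as) n \<le> M / (real (n choose m) / real n ^ m)"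
        by (simp add: m_def mult.commute)
    qed
    have "(\<lambda>n. (real (low n) / real n ^ m) / (real (n choose m) / real n ^ m)) \<longlonglongrightarrow> M / (1 / fact m)"
      by (rule tendsto_divide[OF lowlim nm ne])
    then show "(\<lambda>n. (real (low n) / real n ^ m) / (real (n choose m) / real n ^ m))
        \<longlonglongrightarrow> fact (sum_list as) * profile_sum divided_power (mset as) xs"
      by (simp add: m_def M_def mult.commute)
    have "(\<lambda>n. M / (real (n choose m) / real n ^ m)) \<longlonglongrightarrow> M / (1 / fact m)"
      by (rule tendsto_divide[OF tendsto_const nm ne])
    then show "(\<lambda>n. M / (real (n choose m) / real n ^ m))
        \<longlonglongrightarrow> fact (sum_list as) * profile_sum divided_power (mset as) xs"
      by (simp add: m_def M_def mult.commute)
  qed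
qed

lemma inducibility_clique_free_eq:
  assumes "0 \<notin> set as" "1 \<le> q" "xs \<in> prob_vectors q"
    "\<And>ys. ys \<in> prob_vectors q \<Longrightarrow> profile_sum divided_power (mset as) ys \<le> profile_sum divided_power (mset as) xs"
  shows "inducibility_clique_free (Suc q) (K_partite as) = fact (sum_list as) * profile_sum divided_power (mset as) xs"
  unfolding inducibility_clique_free_def
  using max_density_clique_free_limit[OF assms] by (rule limI)

section \<open>Isomorphic target graphs\<close>

lemma complete_partite_K_partite:
  assumes "as \<noteq> []" "0 \<notin> set as"
  shows "complete_partite (K_partite as)"
proof -
  have "induces (K_partite as) (parcs (K_partite as)) (pverts (K_partite as))"
    unfolding induces_def by (intro exI[of _ id]) auto
  then have "digraph_iso (with_proj (K_partite as)) (with_proj (K_partite as))"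
    using digraph_iso_whole_iff[OF K_partite_wf K_partite_wf] by blast
  then show ?thesis using assms unfolding complete_partite_def by blast
qed

lemma digraph_iso_K_partite_induces:
  assumes "digraph_iso (with_proj (K_partite as)) (with_proj F)"
  shows "parcs F \<subseteq> pverts F \<times> pverts F" "induces (K_partite as) (parcs F) (pverts F)"
proof -
  have wf: "wf_digraph (with_proj (K_partite as))"
    using K_partite_wf[of as] by (auto simp: wf_digraph_def)
  have "wf_digraph (with_proj F)"
    using assms wf_digraph.wf_digraphI_app_iso[OF wf] unfolding digraph_iso_def by metis
  then show *: "parcs F \<subseteq> pverts F \<times> pverts F" by (fastforce simp: wf_digraph_def)
  show "induces (K_partite as) (parcs F) (pverts F)"
    using assms digraph_iso_whole_iff[OF K_partite_wf *] by blast
qed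

lemma induced_density_iso:
  assumes "digraph_iso (with_proj (K_partite as)) (with_proj F)"
  shows "induced_density F G = induced_density (K_partite as) G"
proof -
  note F = digraph_iso_K_partite_induces[OF assms]
  have "copies F (pverts G) (parcs G) = copies (K_partite as) (pverts G) (parcs G)"
    unfolding copies_def induces_trans[OF F(2)] ..
  moreover have "card (pverts F) = card (pverts (K_partite as))" by (rule induces_card[OF F(2)])
  ultimately show ?thesis
    by (simp add: induced_density_def induced_count_eq_card_copies[OF F(1)]
        induced_count_eq_card_copies[OF K_partite_wf])
qed

lemma inducibility_clique_free_iso:
  assumes "digraph_iso (with_proj (K_partite as)) (with_proj F)"
  shows "inducibility_clique_free k F = inducibility_clique_free k (K_partite as)"
  unfolding inducibility_clique_free_def max_density_clique_free_def induced_density_iso[OF assms] ..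

text \<open>
  The order of the parts is irrelevant: \<open>K_partite as\<close> is coloured by first components, with class sizes \<open>as\<close>.
\<close>

lemma digraph_iso_K_partite_mset:
  assumes iso: "digraph_iso (with_proj (K_partite as)) (with_proj F)"
    and as: "mset as = mset bs" "0 \<notin> set as"
  shows "digraph_iso (with_proj (K_partite bs)) (with_proj F)"
proof -
  note F = digraph_iso_K_partite_induces[OF iso]
  have "induces (K_partite bs) (parcs (K_partite as)) (pverts (K_partite as))"
  proof (subst induces_K_partite_iff[where c = fst and q = "length as"])
    have "card {u \<in> pverts (K_partite as). fst u = i} = as ! i" if "i < length as" for i
    proof -
      have "{u \<in> pverts (K_partite as). fst u = i} = {i} \<times> {..<as ! i}"
        using that by (auto simp: pverts_K_partite)
      then show ?thesis by (simp add: card_cartesian_product)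
    qed
    then have "map (\<lambda>i. card {u \<in> pverts (K_partite as). fst u = i}) [0..<length as] = map (\<lambda>i. as ! i) [0..<length as]"
      by simp
    also have "\<dots> = as" by (rule map_nth)
    finally have eq: "map (\<lambda>i. card {u \<in> pverts (K_partite as). fst u = i}) [0..<length as] = as" .
    have "filter (\<lambda>d. d \<noteq> 0) as = as" using as(2) by (intro filter_True ballI) metis
    then show "mset (filter (\<lambda>d. d \<noteq> 0) (map (\<lambda>i. card {u \<in> pverts (K_partite as). fst u = i}) [0..<length as])) = mset bs"
      unfolding eq using as(1) by simp
    show "0 \<notin> set bs" using as mset_eq_setD by metis
  qed (auto simp: pverts_K_partite parcs_K_partite)
  then have "induces (K_partite bs) (parcs F) (pverts F)" using F(2) induces_trans by blast
  then show ?thesis using digraph_iso_whole_iff[OF K_partite_wf F(1)] by blast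
qed

section \<open>Equal or merged parts: a convexity argument\<close>

lemma elem_le_sum_list_nonneg:
  fixes xs :: "real list"
  assumes "\<And>x. x \<in> set xs \<Longrightarrow> 0 \<le> x" "x \<in> set xs"
  shows "x \<le> sum_list xs"
  using assms
proof (induction xs)
  case (Cons y ys)
  then show ?case using sum_list_nonneg[of ys] by fastforce
qed simp

text \<open>
  On the segment \<open>x + y = s\<close> every symmetric polynomial in \<open>x\<close> and \<open>y\<close> is a polynomial in \<open>x * y\<close>. The property asks that it
  has degree at most two there and is convex.
\<close>

definition convex_in_product :: "real \<Rightarrow> (real \<Rightarrow> real \<Rightarrow> real) \<Rightarrow> bool" where
  "convex_in_product s g \<longleftrightarrow> (\<exists>\<alpha> \<beta> \<gamma>. 0 \<le> \<gamma> \<and>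
     (\<forall>x y. x + y = s \<longrightarrow> g x y = \<alpha> + \<beta> * (x * y) + \<gamma> * (x * y) ^ 2))"

lemma convex_in_productI:
  assumes "0 \<le> \<gamma>" "\<And>x y. x + y = s \<Longrightarrow> g x y = \<alpha> + \<beta> * (x * y) + \<gamma> * (x * y) ^ 2"
  shows "convex_in_product s g"
  unfolding convex_in_product_def using assms by blast

lemma convex_in_product_const: "convex_in_product s (\<lambda>x y. c)"
  by (rule convex_in_productI[of 0 _ _ c 0]) auto

lemma convex_in_product_add:
  assumes "convex_in_product s g" "convex_in_product s h"
  shows "convex_in_product s (\<lambda>x y. g x y + h x y)"
proof -
  obtain \<alpha> \<beta> \<gamma> where 1: "0 \<le> \<gamma>" "\<And>x y. x + y = s \<Longrightarrow> g x y = \<alpha> + \<beta> * (x * y) + \<gamma> * (x * y) ^ 2"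
    using assms(1) unfolding convex_in_product_def by blast
  obtain \<alpha>' \<beta>' \<gamma>' where 2: "0 \<le> \<gamma>'" "\<And>x y. x + y = s \<Longrightarrow> h x y = \<alpha>' + \<beta>' * (x * y) + \<gamma>' * (x * y) ^ 2"
    using assms(2) unfolding convex_in_product_def by blast
  show ?thesis
    by (rule convex_in_productI[of "\<gamma> + \<gamma>'" _ _ "\<alpha> + \<alpha>'" "\<beta> + \<beta>'"])
      (use 1 2 in \<open>auto simp: algebra_simps\<close>)
qed

lemma convex_in_product_sum:
  assumes "\<And>i. i \<in> I \<Longrightarrow> convex_in_product s (g i)"
  shows "convex_in_product s (\<lambda>x y. \<Sum>i\<in>I. g i x y)"
  using assms
  by (induction I rule: infinite_finite_induct) (auto simp: convex_in_product_const intro: convex_in_product_add)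

lemma convex_in_product_scale:
  assumes "convex_in_product s g" "0 \<le> c"
  shows "convex_in_product s (\<lambda>x y. c * g x y)"
proof -
  obtain \<alpha> \<beta> \<gamma> where 1: "0 \<le> \<gamma>" "\<And>x y. x + y = s \<Longrightarrow> g x y = \<alpha> + \<beta> * (x * y) + \<gamma> * (x * y) ^ 2"
    using assms(1) unfolding convex_in_product_def by blast
  show ?thesis
    by (rule convex_in_productI[of "c * \<gamma>" _ _ "c * \<alpha>" "c * \<beta>"])
      (use 1 assms(2) in \<open>auto simp: algebra_simps\<close>)
qed

lemma convex_in_product_powers:
  assumes "0 \<le> s" "1 \<le> a" "a \<le> 5"
  shows "convex_in_product s (\<lambda>x y. x ^ a + y ^ a)"
proof -
  consider "a = 1" | "a = 2" | "a = 3" | "a = 4" | "a = 5" using assms by linarith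
  then show ?thesis
  proof cases
    case 1
    show ?thesis by (rule convex_in_productI[of 0 _ _ s 0]) (auto simp: 1)
  next
    case 2
    show ?thesis by (rule convex_in_productI[of 0 _ _ "s ^ 2" "- 2"]) (auto simp: 2 power2_eq_square algebra_simps)
  next
    case 3
    show ?thesis by (rule convex_in_productI[of 0 _ _ "s ^ 3" "- 3 * s"]) (auto simp: 3 eval_nat_numeral algebra_simps)
  next
    case 4
    show ?thesis by (rule convex_in_productI[of 2 _ _ "s ^ 4" "- 4 * s ^ 2"]) (auto simp: 4 eval_nat_numeral algebra_simps)
  next
    case 5
    show ?thesis by (rule convex_in_productI[of "5 * s" _ _ "s ^ 5" "- 5 * s ^ 3"])
      (use assms in \<open>auto simp: 5 eval_nat_numeral algebra_simps\<close>)
  qed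
qed

text \<open>
  The excluded pairs give \<open>x y (s^2 - 2 x y)\<close> and \<open>x y (s^3 - 3 s x y)\<close>, which are concave in \<open>x y\<close>.
\<close>

lemma convex_in_product_mixed:
  assumes "0 \<le> s" "1 \<le> a" "1 \<le> b" "a + b \<le> 5"
    and "{#3, 1#} \<noteq> {#a, b#}" "{#4, 1#} \<noteq> {#a, b#}"
  shows "convex_in_product s (\<lambda>x y. x ^ a * y ^ b + y ^ a * x ^ b)"
proof -
  have "\<not> (a = 3 \<and> b = 1)" "\<not> (a = 1 \<and> b = 3)" "\<not> (a = 4 \<and> b = 1)" "\<not> (a = 1 \<and> b = 4)"
    using assms(5,6) by (auto simp: add_mset_commute)
  then have "a = 1 \<and> b = 1 \<or> a = 1 \<and> b = 2 \<or> a = 2 \<and> b = 1 \<or> a = 2 \<and> b = 2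
      \<or> a = 2 \<and> b = 3 \<or> a = 3 \<and> b = 2" using assms(2-4) by presburger
  then consider "a = 1" "b = 1" | "a = 1" "b = 2" | "a = 2" "b = 1" | "a = 2" "b = 2"
    | "a = 2" "b = 3" | "a = 3" "b = 2" by blast
  then show ?thesis
  proof cases
    case 1
    show ?thesis by (rule convex_in_productI[of 0 _ _ 0 2]) (auto simp: 1)
  next
    case 2
    show ?thesis by (rule convex_in_productI[of 0 _ _ 0 s]) (auto simp: 2 power2_eq_square algebra_simps)
  next
    case 3
    show ?thesis by (rule convex_in_productI[of 0 _ _ 0 s]) (auto simp: 3 power2_eq_square algebra_simps)
  next
    case 4
    show ?thesis by (rule convex_in_productI[of 2 _ _ 0 0]) (auto simp: 4 power2_eq_square algebra_simps)
  next
    case 5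
    show ?thesis by (rule convex_in_productI[of s _ _ 0 0]) (use assms in \<open>auto simp: 5 eval_nat_numeral algebra_simps\<close>)
  next
    case 6
    show ?thesis by (rule convex_in_productI[of s _ _ 0 0]) (use assms in \<open>auto simp: 6 eval_nat_numeral algebra_simps\<close>)
  qed
qed

text \<open>
  Averaging over the exchange of \<open>x\<close> and \<open>y\<close>, which does not change the value, makes every summand symmetric in the two
  classes.
\<close>

lemma profile_sum_two:
  "profile_sum divided_power A (x # y # zs) = profile_sum divided_power A zs
    + (\<Sum>a\<in>set_mset A. (x ^ a + y ^ a) * (profile_sum divided_power (A - {#a#}) zs / fact a))
    + (\<Sum>a\<in>set_mset A. \<Sum>b\<in>set_mset (A - {#a#}).
        (x ^ a * y ^ b + y ^ a * x ^ b) * (profile_sum divided_power (A - {#a#} - {#b#}) zs / (2 * fact a * fact b)))"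
proof -
  define D where "D = (\<lambda>x y. \<Sum>a\<in>set_mset A. \<Sum>b\<in>set_mset (A - {#a#}).
        x ^ a * y ^ b * (profile_sum divided_power (A - {#a#} - {#b#}) zs / (fact a * fact b)))"
  have exp: "profile_sum divided_power A (x # y # zs) = profile_sum divided_power A zs
    + (\<Sum>a\<in>set_mset A. (x ^ a + y ^ a) * (profile_sum divided_power (A - {#a#}) zs / fact a)) + D x y" for x y
  proof -
    have e1: "(\<Sum>a\<in>set_mset A. (x ^ a + y ^ a) * (profile_sum divided_power (A - {#a#}) zs / fact a))
        = (\<Sum>a\<in>set_mset A. divided_power x a * profile_sum divided_power (A - {#a#}) zs)
          + (\<Sum>a\<in>set_mset A. divided_power y a * profile_sum divided_power (A - {#a#}) zs)"
      unfolding sum.distrib[symmetric] by (rule sum.cong) (simp_all add: divided_power_def field_simps)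
    have e2: "D x y = (\<Sum>a\<in>set_mset A. \<Sum>b\<in>set_mset (A - {#a#}).
        divided_power x a * (divided_power y b * profile_sum divided_power (A - {#a#} - {#b#}) zs))"
      unfolding D_def by (intro sum.cong refl) (simp add: divided_power_def)
    show ?thesis unfolding e1 e2 profile_sum.simps(2) distrib_left sum.distrib sum_distrib_left by simp
  qed
  have "D x y = D y x"
    using exp[of x y] exp[of y x] profile_sum_swap[of divided_power A x y zs] by (simp add: add.commute)
  then have "D x y = (D x y + D y x) / 2" by simp
  also have "\<dots> = (\<Sum>a\<in>set_mset A. \<Sum>b\<in>set_mset (A - {#a#}).
        (x ^ a * y ^ b + y ^ a * x ^ b) * (profile_sum divided_power (A - {#a#} - {#b#}) zs / (2 * fact a * fact b)))"
    unfolding D_def sum.distrib[symmetric] sum_divide_distrib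
    by (intro sum.cong refl) (simp add: field_simps)
  finally show ?thesis unfolding exp by simp
qed

lemma profile_sum_convex_in_product:
  assumes A: "sum_mset A \<le> 5" "0 \<notin># A" "\<not> {#3, 1#} \<subseteq># A" "\<not> {#4, 1#} \<subseteq># A"
    and s: "0 \<le> s" and zs: "\<And>z. z \<in> set zs \<Longrightarrow> 0 \<le> z"
  shows "convex_in_product s (\<lambda>x y. profile_sum divided_power A (x # y # zs))"
proof -
  have nn: "0 \<le> profile_sum divided_power B zs" for B
    using zs by (intro profile_sum_nonneg divided_power_nonneg)
  have pair: "{#a, b#} \<subseteq># A" if "a \<in># A" "b \<in># A - {#a#}" for a b
    using that by (simp add: insert_subset_eq_iff)
  have pos: "1 \<le> a" if "a \<in># A" for a using A(2) that by (metis less_one linorder_not_le)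
  have le5: "a \<le> 5" if "a \<in># A" for a
    using A(1) sum_mset.remove[OF that] by simp
  show ?thesis
    unfolding profile_sum_two
  proof (intro convex_in_product_add convex_in_product_const convex_in_product_sum)
    fix a assume a: "a \<in># A"
    have "convex_in_product s (\<lambda>x y. profile_sum divided_power (A - {#a#}) zs / fact a * (x ^ a + y ^ a))"
      using nn s pos[OF a] le5[OF a] by (intro convex_in_product_scale convex_in_product_powers) auto
    then show "convex_in_product s (\<lambda>x y. (x ^ a + y ^ a) * (profile_sum divided_power (A - {#a#}) zs / fact a))"
      by (simp only: mult.commute)
  next
    fix a b assume ab: "a \<in># A" "b \<in># A - {#a#}"
    have "sum_mset {#a, b#} \<le> sum_mset A"
      using pair[OF ab] by (metis subset_mset.add_diff_inverse sum_mset.union le_add1)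
    then have "a + b \<le> 5" using A(1) by simp
    moreover have "{#3, 1#} \<noteq> {#a, b#}" "{#4, 1#} \<noteq> {#a, b#}" using pair[OF ab] A(3,4) by metis+
    moreover have "1 \<le> a" "1 \<le> b" using ab pos in_diffD by metis+
    ultimately have "convex_in_product s (\<lambda>x y. profile_sum divided_power (A - {#a#} - {#b#}) zs / (2 * fact a * fact b)
        * (x ^ a * y ^ b + y ^ a * x ^ b))"
      using nn s by (intro convex_in_product_scale convex_in_product_mixed) auto
    then show "convex_in_product s (\<lambda>x y. (x ^ a * y ^ b + y ^ a * x ^ b)
        * (profile_sum divided_power (A - {#a#} - {#b#}) zs / (2 * fact a * fact b)))"
      by (simp only: mult.commute)
  qed
qed

text \<open>
  As a function of the product \<open>t\<close>, with \<open>0 < t < T\<close> and \<open>T\<close> the value for equal entries, a convex function whose value at \<open>t\<close> is at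
  least that at \<open>T\<close> has at \<open>0\<close> at least the value at \<open>t\<close>.
\<close>

lemma merge_not_worse:
  assumes "convex_in_product (x + y) g" "0 < x" "0 < y" "x \<noteq> y"
    and mx: "\<And>u v. 0 \<le> u \<Longrightarrow> 0 \<le> v \<Longrightarrow> u + v = x + y \<Longrightarrow> g u v \<le> g x y"
  shows "g x y \<le> g (x + y) 0"
proof -
  obtain \<alpha> \<beta> \<gamma> where g: "0 \<le> \<gamma>" "\<And>u v. u + v = x + y \<Longrightarrow> g u v = \<alpha> + \<beta> * (u * v) + \<gamma> * (u * v) ^ 2"
    using assms(1) unfolding convex_in_product_def by blast
  define t where "t = x * y"
  define T where "T = ((x + y) / 2) ^ 2"
  have t: "0 < t" using assms by (simp add: t_def)
  have d: "T - t = ((x - y) / 2) ^ 2" unfolding T_def t_def by (simp add: power2_eq_square field_simps)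
  have "0 < ((x - y) / 2) ^ 2" using assms by simp
  then have tT: "t < T" unfolding d[symmetric] by simp
  have "g ((x + y) / 2) ((x + y) / 2) \<le> g x y" using assms by (intro mx) auto
  then have "\<beta> * T + \<gamma> * T ^ 2 \<le> \<beta> * t + \<gamma> * t ^ 2"
    using g(2)[of x y] g(2)[of "(x + y) / 2" "(x + y) / 2"] by (simp add: t_def T_def power2_eq_square)
  then have "0 \<le> (T - t) * (- \<beta> - \<gamma> * (T + t))" by (simp add: algebra_simps power2_eq_square)
  then have "0 \<le> - \<beta> - \<gamma> * (T + t)" using tT by (simp add: zero_le_mult_iff)
  moreover have "\<gamma> * t \<le> \<gamma> * (T + t)" using g t tT by (intro mult_left_mono) auto
  ultimately have "0 \<le> t * (- \<beta> - \<gamma> * t)" using t by simp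
  then have "\<beta> * t + \<gamma> * t ^ 2 \<le> 0" by (simp add: algebra_simps power2_eq_square)
  then show ?thesis using g(2)[of x y] g(2)[of "x + y" 0] by (simp add: t_def)
qed

text \<open>
  The probability vectors are the image of a compact set of functions, by Tychonoff's theorem.
\<close>

lemma exists_maximizer:
  assumes q: "1 \<le> q"
  shows "\<exists>xs\<in>prob_vectors q. \<forall>ys\<in>prob_vectors q. profile_sum divided_power A ys \<le> profile_sum divided_power A xs"
proof -
  define B :: "(nat \<Rightarrow> real) set" where "B = (\<Pi>\<^sub>E i\<in>UNIV. if i < q then {0..1} else {0})"
  define K where "K = B \<inter> {f. (\<Sum>i<q. f i) = 1}"
  define g where "g = (\<lambda>f :: nat \<Rightarrow> real. profile_sum divided_power A (map f [0..<q]))"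
  have coord: "continuous_on S (\<lambda>f :: nat \<Rightarrow> real. f i)" for i S
    by (rule continuous_on_subset[OF continuous_on_product_coordinates]) simp
  have "compact B"
  proof -
    have "compactin (product_topology (\<lambda>i. euclidean) UNIV) B"
      unfolding B_def compactin_PiE by (auto simp: compactin_euclidean_iff)
    then show ?thesis by (simp add: euclidean_product_topology compactin_euclidean_iff)
  qed
  moreover have "closed {f :: nat \<Rightarrow> real. (\<Sum>i<q. f i) = 1}"
    by (intro closed_Collect_eq continuous_on_sum coord continuous_on_const)
  ultimately have cK: "compact K" unfolding K_def by (rule compact_Int_closed)
  have "(\<lambda>i. if i = 0 then 1 else 0) \<in> K"
    using q by (auto simp: K_def B_def PiE_def extensional_def)
  then have ne: "K \<noteq> {}" by blast
  have cont: "continuous_on K g"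
    unfolding continuous_on_def g_def
  proof
    fix f assume f: "f \<in> K"
    have "((\<lambda>f. f i) \<longlongrightarrow> f i) (at f within K)" for i
      using coord[of K i] f unfolding continuous_on_def by blast
    then show "((\<lambda>f. profile_sum divided_power A (map f [0..<q])) \<longlongrightarrow> profile_sum divided_power A (map f [0..<q])) (at f within K)"
      unfolding profile_sum_map by (intro tendsto_profile_sum) (auto simp: divided_power_def intro!: tendsto_intros)
  qed
  obtain f where f: "f \<in> K" "\<And>h. h \<in> K \<Longrightarrow> g h \<le> g f"
    using continuous_attains_sup[OF cK ne cont] by blast
  have "map f [0..<q] \<in> prob_vectors q"
    using f(1) by (auto simp: prob_vectors_def K_def B_def PiE_def Pi_def atLeast0LessThan
        interv_sum_list_conv_sum_set_nat) (meson atLeastAtMost_iff)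
  moreover have "profile_sum divided_power A ys \<le> profile_sum divided_power A (map f [0..<q])" if ys: "ys \<in> prob_vectors q" for ys
  proof -
    define h where "h = (\<lambda>i. if i < q then ys ! i else 0)"
    have len: "length ys = q" and nn: "\<And>y. y \<in> set ys \<Longrightarrow> 0 \<le> y" and sum: "sum_list ys = 1"
      using ys by (auto simp: prob_vectors_def)
    have hys: "map h [0..<q] = ys" by (rule nth_equalityI) (auto simp: h_def len)
    have "0 \<le> ys ! i \<and> ys ! i \<le> 1" if "i < q" for i
      using nn[of "ys ! i"] elem_le_sum_list_nonneg[of ys "ys ! i"] nn sum that len by auto
    moreover have "(\<Sum>i<q. h i) = 1"
      using sum len by (simp add: sum_list_sum_nth h_def atLeast0LessThan)
    ultimately have "h \<in> K" by (auto simp: K_def B_def h_def PiE_def extensional_def)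
    then show ?thesis using f(2)[of h] hys by (simp add: g_def)
  qed
  ultimately show ?thesis by blast
qed

lemma prob_vectors_mset:
  assumes "xs \<in> prob_vectors q" "mset ys = mset xs"
  shows "ys \<in> prob_vectors q"
  using assms mset_eq_setD[OF assms(2)] mset_eq_length[OF assms(2)]
  by (simp add: prob_vectors_def) (metis sum_mset_sum_list)

text \<open>
  A maximizer with the fewest nonzero entries works: two different nonzero entries could be merged without loss,
  which would decrease the support.
\<close>

lemma exists_uniform_maximizer:
  assumes q: "1 \<le> q"
    and A: "sum_mset A \<le> 5" "0 \<notin># A" "\<not> {#3, 1#} \<subseteq># A" "\<not> {#4, 1#} \<subseteq># A"
  shows "\<exists>xs\<in>prob_vectors q. (\<forall>ys\<in>prob_vectors q. profile_sum divided_power A ys \<le> profile_sum divided_power A xs)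
    \<and> (\<forall>x\<in>set xs. \<forall>y\<in>set xs. x \<noteq> 0 \<longrightarrow> y \<noteq> 0 \<longrightarrow> x = y)"
proof -
  define M where "M = {xs \<in> prob_vectors q. \<forall>ys\<in>prob_vectors q. profile_sum divided_power A ys \<le> profile_sum divided_power A xs}"
  define supp where "supp = (\<lambda>xs :: real list. size (filter_mset (\<lambda>x. x \<noteq> 0) (mset xs)))"
  obtain xs0 where "xs0 \<in> M" using exists_maximizer[OF q, of A] by (auto simp: M_def)
  then obtain xs where xs: "xs \<in> M" "\<And>ys. ys \<in> M \<Longrightarrow> supp xs \<le> supp ys"
    using ex_has_least_nat[of "\<lambda>xs. xs \<in> M" xs0 supp] by blast
  have "x = y" if xy: "x \<in> set xs" "y \<in> set xs" "x \<noteq> 0" "y \<noteq> 0" for x y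
  proof (rule ccontr)
    assume ne: "x \<noteq> y"
    have "y \<in># mset xs - {#x#}" using xy ne by (simp add: in_diff_count)
    then have "{#x, y#} \<subseteq># mset xs" using xy by (simp add: insert_subset_eq_iff)
    then have *: "mset xs = {#x, y#} + (mset xs - {#x, y#})" by (metis subset_mset.add_diff_inverse)
    obtain zs where "mset zs = mset xs - {#x, y#}" using ex_mset by blast
    then have zs: "mset (x # y # zs) = mset xs" using * by simp
    have pv: "x # y # zs \<in> prob_vectors q" using xs zs prob_vectors_mset by (auto simp: M_def)
    then have nn: "0 < x" "0 < y" "\<And>z. z \<in> set zs \<Longrightarrow> 0 \<le> z"
      using xy by (auto simp: prob_vectors_def)
    have val: "profile_sum divided_power A xs = profile_sum divided_power A (x # y # zs)" by (rule profile_sum_mset[OF zs[symmetric]])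
    have pv': "u # v # zs \<in> prob_vectors q" if "0 \<le> u" "0 \<le> v" "u + v = x + y" for u v
      using pv that by (auto simp: prob_vectors_def)
    have cv: "convex_in_product (x + y) (\<lambda>u v. profile_sum divided_power A (u # v # zs))"
      using nn by (intro profile_sum_convex_in_product[OF A]) auto
    have "profile_sum divided_power A xs \<le> profile_sum divided_power A ((x + y) # 0 # zs)"
      unfolding val by (rule merge_not_worse[OF cv nn(1,2) ne])
        (use xs pv' val in \<open>auto simp: M_def simp del: profile_sum.simps\<close>)
    moreover have "profile_sum divided_power A ys \<le> profile_sum divided_power A xs" if "ys \<in> prob_vectors q" for ys
      using xs(1) that by (auto simp: M_def)
    moreover have "(x + y) # 0 # zs \<in> prob_vectors q" using pv'[of "x + y" 0] nn by simp
    ultimately have "(x + y) # 0 # zs \<in> M" unfolding M_def by (blast intro: order_trans)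
    then have "supp xs \<le> supp ((x + y) # 0 # zs)" by (rule xs(2))
    also have "\<dots> < supp (x # y # zs)" using nn by (simp add: supp_def)
    also have "\<dots> = supp xs" by (simp only: supp_def zs)
    finally show False by simp
  qed
  then show ?thesis using xs(1) by (auto simp: M_def)
qed

lemma fact_Rats: "(fact a :: real) \<in> \<rat>"
  by (metis Rats_of_nat of_nat_fact)

lemma profile_sum_divided_power_rational:
  assumes "\<And>x. x \<in> set xs \<Longrightarrow> x \<in> \<rat>"
  shows "profile_sum divided_power A xs \<in> \<rat>"
  using assms
proof (induction xs arbitrary: A)
  case (Cons x xs)
  have "divided_power x a \<in> \<rat>" for a
    using Cons.prems by (auto simp: divided_power_def intro!: Rats_divide Rats_power fact_Rats)
  then show ?case using Cons by (auto intro!: Rats_add Rats_sum Rats_mult)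
qed auto

lemma uniform_entries_rational:
  assumes xs: "xs \<in> prob_vectors q"
    and eq: "\<And>x y. x \<in> set xs \<Longrightarrow> y \<in> set xs \<Longrightarrow> x \<noteq> 0 \<Longrightarrow> y \<noteq> 0 \<Longrightarrow> x = y"
    and x: "x \<in> set xs"
  shows "x \<in> \<rat>"
proof (cases "x = 0")
  case False
  have "sum_list ys = real (length (filter (\<lambda>y. y \<noteq> 0) ys)) * x" if "set ys \<subseteq> set xs" for ys
    using that
  proof (induction ys)
    case (Cons y ys)
    then show ?case using eq[of y x] x False by (auto simp: algebra_simps)
  qed simp
  from this[of xs] have "1 = real (length (filter (\<lambda>y. y \<noteq> 0) xs)) * x"
    using xs by (simp add: prob_vectors_def)
  then have "x = 1 / real (length (filter (\<lambda>y. y \<noteq> 0) xs))"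
    by (metis False nonzero_divide_eq_eq mult.commute mult_zero_left zero_neq_one)
  then show ?thesis by (metis Rats_1 Rats_divide Rats_of_nat)
qed simp

lemma inducibility_clique_free_convex_rational:
  assumes q: "1 \<le> q" and as: "0 \<notin> set as" "sum_list as \<le> 5"
    "\<not> {#3, 1#} \<subseteq># mset as" "\<not> {#4, 1#} \<subseteq># mset as"
  shows "inducibility_clique_free (Suc q) (K_partite as) \<in> \<rat>"
proof -
  have "sum_mset (mset as) \<le> 5" "0 \<notin># mset as" using as by (auto simp: sum_mset_sum_list)
  then obtain xs where xs: "xs \<in> prob_vectors q"
    "\<forall>ys\<in>prob_vectors q. profile_sum divided_power (mset as) ys \<le> profile_sum divided_power (mset as) xs"
    "\<forall>x\<in>set xs. \<forall>y\<in>set xs. x \<noteq> 0 \<longrightarrow> y \<noteq> 0 \<longrightarrow> x = y"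
    using exists_uniform_maximizer[OF q _ _ as(3,4)] by blast
  have "profile_sum divided_power (mset as) xs \<in> \<rat>"
    using uniform_entries_rational[OF xs(1)] xs(3) by (intro profile_sum_divided_power_rational) blast
  moreover have "inducibility_clique_free (Suc q) (K_partite as) = fact (sum_list as) * profile_sum divided_power (mset as) xs"
    using xs(2) by (intro inducibility_clique_free_eq as q xs(1)) blast
  ultimately show ?thesis by (simp add: Rats_mult fact_Rats)
qed

section \<open>Stars with three or four leaves\<close>

abbreviation psum :: "nat \<Rightarrow> real list \<Rightarrow> real" where
  "psum k xs \<equiv> (\<Sum>x\<leftarrow>xs. x ^ k)"

lemma sum_list_weighted_le:
  fixes xs :: "real list" and f :: "real \<Rightarrow> real"
  assumes "\<And>x. x \<in> set xs \<Longrightarrow> f x \<le> B * x"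
  shows "(\<Sum>x\<leftarrow>xs. f x) \<le> B * sum_list xs"
proof -
  have "(\<Sum>x\<leftarrow>xs. f x) \<le> (\<Sum>x\<leftarrow>xs. B * x)" by (rule sum_list_mono) (rule assms)
  then show ?thesis by (simp add: sum_list_const_mult)
qed

text \<open>
  With \<open>m + 1\<close> the number of leaves. If all entries are at most 1/2, then \<open>x ^ m * (1 - x)\<close> is at most its value at 1/2.
  Otherwise there is one larger entry \<open>a\<close>, all others are at most \<open>1 - a\<close>, and by monotonicity replacing
  them by a single entry \<open>1 - a\<close> does not decrease the sum.
\<close>

lemma star_bound:
  fixes xs :: "real list"
  assumes xs: "\<And>x. x \<in> set xs \<Longrightarrow> 0 \<le> x" "sum_list xs = 1"
    and mono: "\<And>x b :: real. 0 \<le> x \<Longrightarrow> x \<le> b \<Longrightarrow> b \<le> 1/2 \<Longrightarrow> x ^ m * (1 - x) \<le> b ^ m * (1 - b)"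
    and half: "(1/2) ^ Suc m \<le> B"
    and two: "\<And>a :: real. 0 \<le> a \<Longrightarrow> a \<le> 1 \<Longrightarrow> a ^ Suc m * (1 - a) + (1 - a) ^ Suc m * a \<le> B"
  shows "psum (Suc m) xs - psum (Suc (Suc m)) xs \<le> B"
proof -
  have eq: "psum (Suc m) ys - psum (Suc (Suc m)) ys = (\<Sum>x\<leftarrow>ys. x * (x ^ m * (1 - x)))" for ys
    by (induction ys) (auto simp: algebra_simps)
  show ?thesis
  proof (cases "\<forall>x\<in>set xs. x \<le> 1/2")
    case True
    have "x * (x ^ m * (1 - x)) \<le> B * x" if "x \<in> set xs" for x
    proof -
      have "x ^ m * (1 - x) \<le> (1/2) ^ m * (1 - 1/2)" using mono[of x "1/2"] xs True that by auto
      also have "\<dots> \<le> B" using half by simp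
      finally show ?thesis using xs(1)[OF that] by (simp add: mult_left_mono mult.commute[of B])
    qed
    then have "(\<Sum>x\<leftarrow>xs. x * (x ^ m * (1 - x))) \<le> B * sum_list xs" by (rule sum_list_weighted_le)
    then show ?thesis unfolding eq xs(2) by simp
  next
    case False
    then obtain a where a: "a \<in> set xs" "1/2 < a" by force
    then obtain ys zs where sp: "xs = ys @ a # zs" by (meson split_list)
    let ?r = "ys @ zs"
    have r: "\<And>x. x \<in> set ?r \<Longrightarrow> 0 \<le> x" "sum_list ?r = 1 - a" using xs by (auto simp: sp)
    have "0 \<le> sum_list ?r" by (rule sum_list_nonneg) (use r in auto)
    then have a1: "a \<le> 1" using r by simp
    have "x * (x ^ m * (1 - x)) \<le> ((1 - a) ^ m * a) * x" if "x \<in> set ?r" for x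
    proof -
      have "x \<le> 1 - a" using elem_le_sum_list_nonneg[of ?r x] r that by simp
      then have "x ^ m * (1 - x) \<le> (1 - a) ^ m * (1 - (1 - a))" using mono[of x "1 - a"] r that a by auto
      then show ?thesis using r(1)[OF that] by (simp add: mult_left_mono mult.commute[of _ x])
    qed
    then have "(\<Sum>x\<leftarrow>?r. x * (x ^ m * (1 - x))) \<le> ((1 - a) ^ m * a) * (1 - a)"
      using sum_list_weighted_le[of ?r "\<lambda>x. x * (x ^ m * (1 - x))" "(1 - a) ^ m * a"] r(2) by simp
    moreover have "(\<Sum>x\<leftarrow>xs. x * (x ^ m * (1 - x))) = a ^ Suc m * (1 - a) + (\<Sum>x\<leftarrow>?r. x * (x ^ m * (1 - x)))"
      by (simp add: sp)
    moreover have "a ^ Suc m * (1 - a) + (1 - a) ^ Suc m * a \<le> B" using two[of a] a a1 by simp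
    ultimately show ?thesis unfolding eq by (simp add: mult_ac)
  qed
qed

text \<open>
  With two classes of product \<open>t\<close> the value is \<open>t (1 - 2 t)\<close>, largest at \<open>t = 1/4\<close>.
\<close>

lemma star_3_bound:
  fixes xs :: "real list"
  assumes "\<And>x. x \<in> set xs \<Longrightarrow> 0 \<le> x" "sum_list xs = 1"
  shows "psum 3 xs - psum 4 xs \<le> 1/8"
proof -
  have "psum (Suc 2) xs - psum (Suc (Suc 2)) xs \<le> 1/8"
  proof (rule star_bound[OF assms])
    fix x b :: real assume xb: "0 \<le> x" "x \<le> b" "b \<le> 1/2"
    have "b * b \<le> b * (1/2)" "b * x \<le> (1/2) * x" "x * x \<le> x * (1/2)"
      by (intro mult_left_mono mult_right_mono; use xb in simp)+
    then have "0 \<le> (b - x) * (b + x - (b * b + b * x + x * x))"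
      using xb by (intro mult_nonneg_nonneg) auto
    also have "\<dots> = b ^ 2 * (1 - b) - x ^ 2 * (1 - x)" by algebra
    finally show "x ^ 2 * (1 - x) \<le> b ^ 2 * (1 - b)" by simp
  next
    fix a :: real
    have "1/8 - (a ^ Suc 2 * (1 - a) + (1 - a) ^ Suc 2 * a) = 2 * (a * (1 - a) - 1/4) ^ 2"
      by (simp add: field_simps power2_eq_square eval_nat_numeral)
    then show "a ^ Suc 2 * (1 - a) + (1 - a) ^ Suc 2 * a \<le> 1/8"
      using zero_le_power2[of "a * (1 - a) - 1/4"] by linarith
  qed (simp_all add: eval_nat_numeral)
  then show ?thesis by (simp add: eval_nat_numeral)
qed

text \<open>
  With two classes of product \<open>t\<close> the value is \<open>t (1 - 3 t)\<close>, largest at \<open>t = 1/6\<close>.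
\<close>

lemma star_4_bound:
  fixes xs :: "real list"
  assumes "\<And>x. x \<in> set xs \<Longrightarrow> 0 \<le> x" "sum_list xs = 1"
  shows "psum 4 xs - psum 5 xs \<le> 1/12"
proof -
  have "psum (Suc 3) xs - psum (Suc (Suc 3)) xs \<le> 1/12"
  proof (rule star_bound[OF assms])
    fix x b :: real assume xb: "0 \<le> x" "x \<le> b" "b \<le> 1/2"
    have "b * b * b \<le> b * b * (1/2)" "b * b * x \<le> b * (1/2) * x" "b * x * x \<le> (1/2) * x * x"
        "x * x * x \<le> x * x * (1/2)"
      by (intro mult_left_mono mult_right_mono; use xb in simp)+
    moreover have "0 \<le> b * b" "0 \<le> b * x" "0 \<le> x * x" using xb by auto
    ultimately have "b * b * b + b * b * x + b * x * x + x * x * x \<le> b * b + b * x + x * x"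
      by linarith
    then have "0 \<le> (b - x) * (b * b + b * x + x * x - (b * b * b + b * b * x + b * x * x + x * x * x))"
      using xb by (intro mult_nonneg_nonneg) auto
    also have "\<dots> = b ^ 3 * (1 - b) - x ^ 3 * (1 - x)" by algebra
    finally show "x ^ 3 * (1 - x) \<le> b ^ 3 * (1 - b)" by simp
  next
    fix a :: real
    have "1/12 - (a ^ Suc 3 * (1 - a) + (1 - a) ^ Suc 3 * a) = 3 * (a * (1 - a) - 1/6) ^ 2"
      by (simp add: field_simps power2_eq_square eval_nat_numeral)
    then show "a ^ Suc 3 * (1 - a) + (1 - a) ^ Suc 3 * a \<le> 1/12"
      using zero_le_power2[of "a * (1 - a) - 1/6"] by linarith
  qed (simp_all add: eval_nat_numeral)
  then show ?thesis by (simp add: eval_nat_numeral)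
qed

lemma profile_sum_single: "1 \<le> m \<Longrightarrow> profile_sum divided_power {#m#} xs = psum m xs / fact m"
  by (induction xs) (auto simp: divided_power_def add_divide_distrib)

lemma profile_sum_star:
  assumes "2 \<le> m"
  shows "profile_sum divided_power {#m, 1#} xs = (psum m xs * psum 1 xs - psum (Suc m) xs) / fact m"
proof (induction xs)
  case (Cons x xs)
  have "{#m, 1#} - {#m#} = {#1#}" "{#m, 1#} - {#1#} = {#m#}" using assms by auto
  then have "profile_sum divided_power {#m, 1#} (x # xs) = profile_sum divided_power {#m, 1#} xs
      + divided_power x m * profile_sum divided_power {#1#} xs + divided_power x 1 * profile_sum divided_power {#m#} xs"
    using assms by simp
  also have "\<dots> = (psum m (x # xs) * psum 1 (x # xs) - psum (Suc m) (x # xs)) / fact m"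
    unfolding Cons using assms by (simp add: profile_sum_single divided_power_def) (simp add: field_simps)
  finally show ?case .
qed (use assms in simp)

lemma profile_sum_11: "profile_sum divided_power {#1, 1#} xs = ((psum 1 xs) ^ 2 - psum 2 xs) / 2"
proof (induction xs)
  case (Cons x xs)
  have "profile_sum divided_power {#1, 1#} (x # xs) = profile_sum divided_power {#1, 1#} xs + divided_power x 1 * profile_sum divided_power {#1#} xs"
    by simp
  also have "\<dots> = ((psum 1 (x # xs)) ^ 2 - psum 2 (x # xs)) / 2"
    unfolding Cons profile_sum_single[OF order_refl] by (simp add: divided_power_def field_simps power2_eq_square)
  finally show ?case .
qed simp

lemma profile_sum_311:
  "profile_sum divided_power {#3, 1, 1#} xs = (psum 3 xs * ((psum 1 xs) ^ 2 - psum 2 xs) - 2 * psum 4 xs * psum 1 xs + 2 * psum 5 xs) / 12"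
proof (induction xs)
  case (Cons x xs)
  have star: "profile_sum divided_power {#3, 1#} xs = (psum 3 xs * psum 1 xs - psum 4 xs) / 6"
    using profile_sum_star[of 3 xs] by (simp add: fact_numeral)
  have "{#3, 1, 1#} - {#3#} = {#1, 1::nat#}" "{#3, 1, 1#} - {#1#} = {#3, 1::nat#}" by auto
  then have "profile_sum divided_power {#3, 1, 1#} (x # xs) = profile_sum divided_power {#3, 1, 1#} xs
      + divided_power x 3 * profile_sum divided_power {#1, 1#} xs + divided_power x 1 * profile_sum divided_power {#3, 1#} xs"
    by simp
  also have "\<dots> = (psum 3 (x # xs) * ((psum 1 (x # xs)) ^ 2 - psum 2 (x # xs))
      - 2 * psum 4 (x # xs) * psum 1 (x # xs) + 2 * psum 5 (x # xs)) / 12"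
    unfolding Cons profile_sum_11 star
    by (simp add: divided_power_def fact_numeral) (simp add: field_simps eval_nat_numeral)
  finally show ?case .
qed simp

lemma psum_1: "psum 1 xs = sum_list xs"
  by simp

text \<open>
  The bound \<open>B\<close> need only be attained by two classes, whose sizes may be irrational. A single class contains no star.
\<close>

lemma inducibility_clique_free_star_rational:
  assumes q: "1 \<le> q" and as: "mset as = {#m, 1#}" and m: "2 \<le> m"
    and bound: "\<And>xs. (\<And>x. x \<in> set xs \<Longrightarrow> 0 \<le> x) \<Longrightarrow> sum_list xs = 1 \<Longrightarrow> psum m xs - psum (Suc m) xs \<le> B"
    and xy: "0 \<le> x" "0 \<le> y" "x + y = 1" "x ^ m - x ^ Suc m + (y ^ m - y ^ Suc m) = B" and B: "B \<in> \<rat>"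
  shows "inducibility_clique_free (Suc q) (K_partite as) \<in> \<rat>"
proof -
  have as0: "0 \<notin> set as" 
  proof -
    have "set_mset (mset as) = {m, 1}" unfolding as by simp
    then show ?thesis using m by simp
  qed
  have val: "profile_sum divided_power (mset as) ys = (psum m ys - psum (Suc m) ys) / fact m" if "ys \<in> prob_vectors q" for ys
    using that profile_sum_star[OF m, of ys] unfolding as psum_1 by (simp add: prob_vectors_def)
  show ?thesis
  proof (cases "q = 1")
    case True
    have one: "ys = [1]" if "ys \<in> prob_vectors 1" for ys
      using that by (auto simp: prob_vectors_def length_Suc_conv)
    have "[1] \<in> prob_vectors 1" by (simp add: prob_vectors_def)
    then have "inducibility_clique_free (Suc 1) (K_partite as) = fact (sum_list as) * profile_sum divided_power (mset as) [1]"
    proof (rule inducibility_clique_free_eq[OF as0 order_refl])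
      fix ys assume "ys \<in> prob_vectors 1"
      from one[OF this] show "profile_sum divided_power (mset as) ys \<le> profile_sum divided_power (mset as) [1]" by simp
    qed
    moreover have "profile_sum divided_power (mset as) [1] \<in> \<rat>" by (rule profile_sum_divided_power_rational) simp
    ultimately show ?thesis unfolding True by (simp add: Rats_mult fact_Rats del: profile_sum.simps)
  next
    case False
    define xs where "xs = x # y # replicate (q - 2) 0"
    have xs: "xs \<in> prob_vectors q" using q False xy by (auto simp: xs_def prob_vectors_def sum_list_replicate)
    have "profile_sum divided_power (mset as) xs = B / fact m"
    proof -
      have "(0::real) ^ m = 0" using m by simp
      then have "psum m xs - psum (Suc m) xs = x ^ m + y ^ m - (x ^ Suc m + y ^ Suc m)"
        by (simp add: xs_def sum_list_replicate map_replicate)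
      then have "psum m xs - psum (Suc m) xs = B" using xy(4) by linarith
      then show ?thesis unfolding val[OF xs] by simp
    qed
    moreover have "profile_sum divided_power (mset as) ys \<le> B / fact m" if "ys \<in> prob_vectors q" for ys
      using bound[of ys] that unfolding val[OF that] by (intro divide_right_mono) (auto simp: prob_vectors_def)
    ultimately have "inducibility_clique_free (Suc q) (K_partite as) = fact (sum_list as) * (B / fact m)"
      using inducibility_clique_free_eq[OF as0 q xs] by simp
    then show ?thesis using B fact_Rats by (simp add: Rats_mult Rats_divide)
  qed
qed

lemma mset_sum_le_1_cases:
  assumes "0 \<notin># A" "sum_mset A \<le> 1"
  shows "A = {#} \<or> A = {#1::nat#}"
proof (cases A)
  case (add a B)
  have a: "a = 1" using assms add by (cases a) auto
  have "B = {#}"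
  proof (cases B)
    case (add b C)
    then show ?thesis using assms \<open>A = add_mset a B\<close> a by (cases b) auto
  qed simp
  then show ?thesis using a add by simp
qed simp

text \<open>
  A complete partite graph on at most five vertices with parts of sizes 3 and 1 is \<open>K_{3,1}\<close> or \<open>K_{3,1,1}\<close>, and one with parts of sizes 4 and 1 is
  \<open>K_{4,1}\<close>. All others fall under the convexity argument.
\<close>

lemma inducibility_clique_free_rational:
  assumes q: "1 \<le> q" and as: "0 \<notin> set as" "sum_list as \<le> 5" "mset as \<noteq> {#3, 1, 1#}"
  shows "inducibility_clique_free (Suc q) (K_partite as) \<in> \<rat>"
proof -
  have s5: "sum_mset (mset as) \<le> 5" using as by (simp add: sum_mset_sum_list)
  have rest: "mset as = {#m, 1#} \<or> mset as = {#m, 1, 1#} \<and> m + 2 \<le> 5"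
    if sub: "{#m, 1#} \<subseteq># mset as" "4 \<le> m + 1" for m
  proof -
    obtain B where B: "mset as = {#m, 1#} + B" using sub(1) by (metis subset_mset.le_iff_add)
    have "0 \<notin># B" using as(1) B by (metis set_mset_mset union_iff)
    moreover have "m + 1 + sum_mset B \<le> 5" using s5 B by simp
    moreover then have "sum_mset B \<le> 1" using sub(2) by simp
    ultimately show ?thesis using mset_sum_le_1_cases[of B] B by auto
  qed
  consider "{#3, 1#} \<subseteq># mset as" | "{#4, 1#} \<subseteq># mset as"
    | "\<not> {#3, 1#} \<subseteq># mset as" "\<not> {#4, 1#} \<subseteq># mset as" by blast
  then show ?thesis
  proof cases
    case 1
    then have "mset as = {#3, 1#}" using rest[of 3] as(3) by auto
    then show ?thesis
    proof (rule inducibility_clique_free_star_rational[OF q])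
      fix xs :: "real list" assume "\<And>x. x \<in> set xs \<Longrightarrow> 0 \<le> x" "sum_list xs = 1"
      then show "psum 3 xs - psum (Suc 3) xs \<le> 1/8" using star_3_bound[of xs] by simp
    next
      show "(1/2::real) ^ 3 - (1/2) ^ Suc 3 + ((1/2) ^ 3 - (1/2) ^ Suc 3) = 1/8" by (simp add: eval_nat_numeral)
    qed auto
  next
    case 2
    then have as41: "mset as = {#4, 1#}" using rest[of 4] by auto
    \<comment> \<open>The solution of \<open>x (1 - x) = 1/6\<close>, where the bound for the star with four leaves is attained.\<close>
    define x :: real where "x = (1 + 1 / sqrt 3) / 2"
    have x01: "0 \<le> x" "0 \<le> 1 - x" unfolding x_def by (auto simp: field_simps)
    have xx: "x * (1 - x) = 1/6"
      unfolding x_def by (simp add: field_simps)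
    have "x ^ 4 - x ^ Suc 4 + ((1 - x) ^ 4 - (1 - x) ^ Suc 4) = x * (1 - x) * (1 - 3 * (x * (1 - x)))"
      by (simp add: eval_nat_numeral algebra_simps)
    then have x4: "x ^ 4 - x ^ Suc 4 + ((1 - x) ^ 4 - (1 - x) ^ Suc 4) = 1/12"
      unfolding xx by simp
    show ?thesis
    proof (rule inducibility_clique_free_star_rational[OF q as41])
      fix xs :: "real list" assume "\<And>x. x \<in> set xs \<Longrightarrow> 0 \<le> x" "sum_list xs = 1"
      then show "psum 4 xs - psum (Suc 4) xs \<le> 1/12" using star_4_bound[of xs] by simp
    next
      show "x ^ 4 - x ^ Suc 4 + ((1 - x) ^ 4 - (1 - x) ^ Suc 4) = 1/12" by (rule x4)
    qed (use x01 in auto)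
  next
    case 3
    then show ?thesis using inducibility_clique_free_convex_rational[OF q as(1,2)] by blast
  qed
qed

section \<open>The inducibility of the complete partite graph with parts 3, 1, 1\<close>

text \<open>
  A class of size \<open>a\<close> with a clique on the rest has this value, up to a constant factor. It is largest at \<open>a = 3/5\<close>, a double
  root of the difference.
\<close>

lemma one_large_part_value:
  fixes a :: real
  assumes "0 \<le> a" "a \<le> 1"
  shows "a ^ 3 * (1 - a) ^ 2 \<le> 108/3125"
proof -
  have "a * a * a \<le> a * a * 1" "a * a \<le> a * 1" using assms by (intro mult_left_mono; simp)+
  then have "0 \<le> 12/125 + 8/25 * a + 4/5 * (a * a) - a * a * a" using assms by linarith
  then have "0 \<le> (a - 3/5) ^ 2 * (12/125 + 8/25 * a + 4/5 * (a * a) - a * a * a)" by simp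
  also have "\<dots> = 108/3125 - a ^ 3 * (1 - a) ^ 2" by (simp add: field_simps eval_nat_numeral)
  finally show ?thesis by simp
qed

text \<open>
  Let \<open>a = sqrt c\<close>, the largest possible entry of a nonnegative vector with sum of squares \<open>c\<close>. At \<open>x = a\<close> the left-hand side is
  \<open>a^3 (1 - a)^2\<close>. For \<open>c \<le> 1/3\<close> the cubic \<open>k\<close> is increasing, so this is its maximum. For \<open>c > 1/3\<close> it is convex on
  \<open>[1/3, a]\<close>, so that it is largest at an endpoint, and on \<open>[0, 1/3]\<close> a crude estimate has room to spare.
\<close>

lemma kernel_bound:
  fixes c x :: real
  assumes c: "0 \<le> c" "c \<le> 1" and x: "0 \<le> x" "x ^ 2 \<le> c"
  shows "c * (x * (1 - c) - 2 * x ^ 2 + 2 * x ^ 3) \<le> 108/3125"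
proof -
  define a where "a = sqrt c"
  have a: "0 \<le> a" "a \<le> 1" "c = a ^ 2" "x \<le> a"
    using c x real_le_rsqrt by (auto simp: a_def)
  define k where "k = (\<lambda>x. x * (1 - c) - 2 * x ^ 2 + 2 * x ^ 3)"
  have ka: "c * k a \<le> 108/3125"
  proof -
    have "c * k a = a ^ 3 * (1 - a) ^ 2" unfolding k_def a(3) by algebra
    then show ?thesis using one_large_part_value a by simp
  qed
  have diff: "k y - k x = (y - x) * (1 - c - 2 * (y + x) + 2 * (y ^ 2 + y * x + x ^ 2))" for y x
    unfolding k_def by algebra
  have le: "k x \<le> k a" if "0 \<le> 1 - c - 2 * (a + x) + 2 * (a ^ 2 + a * x + x ^ 2)"
    using diff[of a x] mult_nonneg_nonneg[OF _ that, of "a - x"] a by simp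
  have third: "c * k y \<le> 108/3125" if y: "0 \<le> y" "y \<le> 1/3" "1/3 < c" for y
  proof -
    have "0 \<le> (c - 1/2) ^ 2" by simp
    then have "c * (1 - c) \<le> 1/4" by (simp add: power2_eq_square algebra_simps)
    then have 1: "y * (c * (1 - c)) \<le> y * (1/4)" using y by (intro mult_left_mono)
    have "1/3 * (y ^ 2 * (1 - y)) \<le> c * (y ^ 2 * (1 - y))" using y by (intro mult_right_mono) auto
    then have 2: "c * k y \<le> y / 4 - 2/3 * (y ^ 2 * (1 - y))"
      using 1 unfolding k_def by (simp add: algebra_simps power2_eq_square power3_eq_cube)
    have "0 \<le> (1/3 - y) * (2/3 * (y - 1/3) ^ 2 + 1/108)" using y by (intro mult_nonneg_nonneg) auto
    also have "\<dots> \<le> 108/3125 - (y / 4 - 2/3 * (y ^ 2 * (1 - y)))"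
      using y by (simp add: field_simps power2_eq_square)
    finally show ?thesis using 2 by linarith
  qed
  have "c * k x \<le> 108/3125"
  proof (cases "c \<le> 1/3")
    case True
    have "0 \<le> 3/2 * (a + x - 2/3) ^ 2 + 1/2 * (a - x) ^ 2" by simp
    also have "\<dots> = 2/3 - 2 * (a + x) + 2 * (a ^ 2 + a * x + x ^ 2)"
      by (simp add: field_simps power2_eq_square)
    finally have "k x \<le> k a" using True by (intro le) linarith
    then have "c * k x \<le> c * k a" using c by (rule_tac mult_left_mono)
    then show ?thesis using ka by simp
  next
    case False
    consider "x \<le> 1/3" | "1/3 < x" "0 \<le> 1 - c - 2 * (a + x) + 2 * (a ^ 2 + a * x + x ^ 2)"
      | "1/3 < x" "1 - c - 2 * (a + x) + 2 * (a ^ 2 + a * x + x ^ 2) < 0" by linarith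
    then show ?thesis
    proof cases
      case 1
      then show ?thesis using third x False by simp
    next
      case 2
      then have "c * k x \<le> c * k a" using c le by (intro mult_left_mono) auto
      then show ?thesis using ka by simp
    next
      case 3
      have "0 \<le> 2 * (a - 1/3) * (a + x - 2/3)" using 3 a by (intro mult_nonneg_nonneg) auto
      then have "1 - c - 2 * (1/3 + x) + 2 * ((1/3) ^ 2 + 1/3 * x + x ^ 2) \<le> 0"
        using 3 by (simp add: field_simps power2_eq_square)
      then have "k x \<le> k (1/3)"
        using diff[of "1/3" x] mult_nonpos_nonpos[of "1/3 - x"] 3 by fastforce
      then have "c * k x \<le> c * k (1/3)" using c by (intro mult_left_mono)
      moreover have "c * k (1/3) \<le> 108/3125" using False by (intro third) auto
      ultimately show ?thesis by linarith
    qed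
  qed
  then show ?thesis by (simp add: k_def)
qed

text \<open>
  Let \<open>c\<close> be the sum of squares. The left-hand side is the average, with weights \<open>x^2 / c\<close>, of the quantities bounded in
  \<open>kernel_bound\<close>, and every entry satisfies \<open>x^2 \<le> c\<close>.
\<close>

lemma large_part_bound:
  fixes xs :: "real list"
  assumes xs: "\<And>x. x \<in> set xs \<Longrightarrow> 0 \<le> x" "sum_list xs = 1"
  shows "psum 3 xs * (1 - psum 2 xs) - 2 * psum 4 xs + 2 * psum 5 xs \<le> 108/3125"
proof -
  define c where "c = psum 2 xs"
  have xle: "x \<le> 1" if "x \<in> set xs" for x using elem_le_sum_list_nonneg[of xs x] xs that by simp
  have sq: "x ^ 2 \<le> c" if "x \<in> set xs" for x
    unfolding c_def by (rule elem_le_sum_list_nonneg) (use that in auto)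
  have c0: "0 \<le> c" unfolding c_def by (intro sum_list_nonneg) auto
  have c1: "c \<le> 1"
  proof -
    have "c \<le> 1 * sum_list xs" unfolding c_def
      by (rule sum_list_weighted_le) (use xs xle in \<open>auto simp: power2_eq_square intro: mult_left_le\<close>)
    then show ?thesis using xs by simp
  qed
  have "c \<noteq> 0"
  proof
    assume "c = 0"
    then have x0: "x = 0" if "x \<in> set xs" for x using sq[OF that] by simp
    have "(\<Sum>x\<leftarrow>xs. x) \<le> 0 * sum_list xs"
      by (rule sum_list_weighted_le) (drule x0, simp)
    then show False using xs by simp
  qed
  have eq: "psum 3 ys * (1 - c) - 2 * psum 4 ys + 2 * psum 5 ys
      = (\<Sum>x\<leftarrow>ys. x ^ 2 * (x * (1 - c) - 2 * x ^ 2 + 2 * x ^ 3))" for ys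
    by (induction ys) (simp_all add: algebra_simps eval_nat_numeral)
  have "c * (\<Sum>x\<leftarrow>xs. x ^ 2 * (x * (1 - c) - 2 * x ^ 2 + 2 * x ^ 3))
      = (\<Sum>x\<leftarrow>xs. x ^ 2 * (c * (x * (1 - c) - 2 * x ^ 2 + 2 * x ^ 3)))"
    by (simp add: sum_list_const_mult[symmetric] mult_ac)
  also have "\<dots> \<le> (\<Sum>x\<leftarrow>xs. x ^ 2 * (108/3125))"
    using kernel_bound[OF c0 c1] xs sq by (intro sum_list_mono mult_left_mono) auto
  also have "\<dots> = c * (108/3125)" unfolding c_def by (rule sum_list_mult_const)
  finally show ?thesis using c0 \<open>c \<noteq> 0\<close> unfolding eq[of xs] c_def[symmetric]
    by (simp only: mult_le_cancel_left)
qed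

lemma profile_sum_choose_zeros:
  "0 \<notin># A \<Longrightarrow> profile_sum (\<lambda>k a. k choose a) A (replicate k 0) = (if A = {#} then 1 else 0)"
proof (induction k)
  case (Suc k)
  have "(\<Sum>a\<in>set_mset A. (0 choose a) * profile_sum (\<lambda>k a. k choose a) (A - {#a#}) (replicate k 0)) = 0"
    using Suc.prems by (intro sum.neutral ballI) (metis binomial_eq_0 gr0I mult_zero_left)
  then show ?case using Suc by simp
qed simp

lemma profile_sum_choose_ones:
  "profile_sum (\<lambda>k a. k choose a) {#1, 1#} (replicate l 1 @ replicate k 0) = l choose 2"
proof (induction l)
  case 0
  then show ?case by (simp add: profile_sum_choose_zeros numeral_2_eq_2)
next
  case (Suc l)
  have "profile_sum (\<lambda>k a. k choose a) {#1#} (replicate l 1 @ replicate k 0) = l"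
    by (induction l) (auto simp: profile_sum_choose_zeros)
  then show ?case using Suc by (simp add: numeral_2_eq_2)
qed

text \<open>
  The upper bound holds for every number of classes. The lower bound is attained asymptotically by an independent set of
  \<open>3 n / 5\<close> vertices joined completely to a clique on the rest, that is, by one large class and singletons.
\<close>

lemma max_density_K311_limit: "max_density (K_partite [3, 1, 1]) \<longlonglongrightarrow> 216/625"
proof (rule tendsto_sandwich)
  define f where "f = (\<lambda>n. nat \<lfloor>3/5 * real n\<rfloor>)"
  define low where "low = (\<lambda>n. (real (f n choose 3) / real n ^ 3 * (real (n - f n choose 2) / real n ^ 2))
      / (real (n choose 5) / real n ^ 5))"
  have fle: "f n \<le> n" for n unfolding f_def by linarith
  have flim: "(\<lambda>n. real (f n) / real n) \<longlonglongrightarrow> 3/5"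
    unfolding f_def by (rule tendsto_floor_mult) simp
  have "(\<lambda>n. 1 - real (f n) / real n) \<longlonglongrightarrow> 1 - 3/5"
    by (intro tendsto_diff tendsto_const flim)
  moreover have "\<forall>\<^sub>F n in sequentially. 1 - real (f n) / real n = real (n - f n) / real n"
    by (rule eventually_sequentiallyI[of 1]) (simp add: fle of_nat_diff field_simps)
  ultimately have glim: "(\<lambda>n. real (n - f n) / real n) \<longlonglongrightarrow> 1 - 3/5" by (rule Lim_transform_eventually)
  have "low \<longlonglongrightarrow> (divided_power (3/5) 3 * divided_power (1 - 3/5) 2) / (1 / fact 5)"
    unfolding low_def
    by (intro tendsto_divide tendsto_mult tendsto_choose flim glim tendsto_choose_normalized) simp
  also have "(divided_power (3/5) 3 * divided_power (1 - 3/5) 2) / (1 / fact 5) = 216/625"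
    by (simp add: divided_power_def fact_numeral power_divide)
  finally show "low \<longlonglongrightarrow> 216/625" .
  show "\<forall>\<^sub>F n in sequentially. low n \<le> max_density (K_partite [3, 1, 1]) n"
  proof (rule eventually_sequentiallyI[of 2])
    fix n :: nat assume n: "2 \<le> n"
    \<comment> \<open>Empty classes pad the list of sizes to length \<open>n\<close>.\<close>
    define ns where "ns = f n # (replicate (n - f n) 1 @ replicate (f n - 1) 0)"
    have "1 \<le> f n" using n unfolding f_def by linarith
    then have ns: "length ns = n" "sum_list ns = n" using fle[of n] by (auto simp: ns_def sum_list_replicate)
    have "(f n choose 3) * (n - f n choose 2) =
        (f n choose 3) * profile_sum (\<lambda>k a. k choose a) {#1, 1#} (replicate (n - f n) 1 @ replicate (f n - 1) 0)"
      by (simp only: profile_sum_choose_ones)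
    also have "\<dots> \<le> profile_sum (\<lambda>k a. k choose a) (mset [3, 1, 1]) ns"
      unfolding ns_def by simp
    finally have "real ((f n choose 3) * (n - f n choose 2)) / real (n choose 5)
        \<le> real (profile_sum (\<lambda>k a. k choose a) (mset [3, 1, 1]) ns) / real (n choose 5)"
      by (intro divide_right_mono) (simp_all only: of_nat_le_iff of_nat_0_le_iff)
    also have "\<dots> \<le> max_density (K_partite [3, 1, 1]) n"
      using max_density_clique_free_ge_profile[of "[3, 1, 1]" ns n n] ns by (simp add: max_density_eq_clique_free)
    finally have "real ((f n choose 3) * (n - f n choose 2)) / real (n choose 5) \<le> max_density (K_partite [3, 1, 1]) n" .
    moreover have "low n = real ((f n choose 3) * (n - f n choose 2)) / real (n choose 5)"
      using n by (simp add: low_def field_simps eval_nat_numeral)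
    ultimately show "low n \<le> max_density (K_partite [3, 1, 1]) n" by simp
  qed
  show "\<forall>\<^sub>F n in sequentially. max_density (K_partite [3, 1, 1]) n \<le> (9/3125) / (real (n choose 5) / real n ^ 5)"
  proof (rule eventually_sequentiallyI[of 1])
    fix n :: nat assume n: "1 \<le> n"
    have "max_density_clique_free (Suc n) (K_partite [3, 1, 1]) n \<le> (real n ^ 5 * (9/3125)) / real (n choose sum_list [3, 1, 1])"
    proof (rule max_density_clique_free_le_profile)
      fix ns assume ns: "length ns = n" "sum_list ns = n"
      let ?xs = "map (\<lambda>k. real k / real n) ns"
      have pv: "?xs \<in> prob_vectors n" using n ns by (intro normalized_prob_vector) auto
      have "profile_sum divided_power (mset [3, 1, 1]) ?xs
          = (psum 3 ?xs * (1 - psum 2 ?xs) - 2 * psum 4 ?xs + 2 * psum 5 ?xs) / 12"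
        using pv profile_sum_311[of ?xs] unfolding psum_1 by (simp add: prob_vectors_def del: map_map)
      also have "\<dots> \<le> (108/3125) / 12"
        by (intro divide_right_mono large_part_bound) (use pv in \<open>auto simp: prob_vectors_def\<close>)
      finally have le: "profile_sum divided_power (mset [3, 1, 1]) ?xs \<le> 9/3125" by simp
      have "real (profile_sum (\<lambda>k a. k choose a) (mset [3, 1, 1]) ns) \<le> real n ^ 5 * profile_sum divided_power (mset [3, 1, 1]) ?xs"
        using profile_sum_choose_le[of n "mset [3, 1, 1]" ns] n by simp
      also have "\<dots> \<le> real n ^ 5 * (9/3125)" by (intro mult_left_mono le) simp
      finally show "real (profile_sum (\<lambda>k a. k choose a) (mset [3, 1, 1]) ns) \<le> real n ^ 5 * (9/3125)" .
    qed (use n in auto)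
    then show "max_density (K_partite [3, 1, 1]) n \<le> (9/3125) / (real (n choose 5) / real n ^ 5)"
      by (simp add: max_density_eq_clique_free mult.commute)
  qed
  have "(\<lambda>n. (9/3125) / (real (n choose 5) / real n ^ 5)) \<longlonglongrightarrow> (9/3125) / (1 / fact 5)"
    by (rule tendsto_divide[OF tendsto_const tendsto_choose_normalized]) simp
  then show "(\<lambda>n. (9/3125) / (real (n choose 5) / real n ^ 5)) \<longlonglongrightarrow> 216/625"
    by (simp add: fact_numeral)
qed

section \<open>Four parts and the quadratic irrationality\<close>

text \<open>
  Six times the density polynomial of \<open>K_{3,1,1}\<close> for four classes.
\<close>

definition four_part :: "real \<Rightarrow> real \<Rightarrow> real \<Rightarrow> real \<Rightarrow> real" where
  "four_part a x y z = a ^ 3 * (x * y + x * z + y * z) + x ^ 3 * (a * y + a * z + y * z)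
     + y ^ 3 * (a * x + a * z + x * z) + z ^ 3 * (a * x + a * y + x * y)"

text \<open>
  The value of \<open>four_part\<close> at \<open>(1 - 3 b, b, b, b)\<close>, see \<open>four_part_one_three\<close>.
\<close>

definition one_three :: "real \<Rightarrow> real" where
  "one_three b = 3 * b ^ 2 - 27 * b ^ 3 + 87 * b ^ 4 - 96 * b ^ 5"

text \<open>
  The smaller root of \<open>40 b^2 - 19 b + 2\<close>. The derivative of \<open>one_three\<close> is \<open>3 b (1 - 4 b) (40 b^2 - 19 b + 2)\<close>, so that this
  is a local maximum, while \<open>b = 1/4\<close> is a local minimum.
\<close>

definition bstar :: real where "bstar = (19 - sqrt 41) / 80"

lemma four_part_one_three: "four_part (1 - 3 * b) b b b = one_three b"
  unfolding four_part_def one_three_def by algebra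

text \<open>
  Nonpositive discriminant of the difference; this removes \<open>q\<close> and leaves an inequality in one variable.
\<close>

lemma quadratic_bound:
  fixes \<alpha> \<beta> q B :: real
  assumes "0 < \<alpha>" "\<beta> ^ 2 \<le> 4 * \<alpha> * B"
  shows "\<beta> * q - \<alpha> * q ^ 2 \<le> B"
proof -
  have "0 \<le> (\<beta> - 2 * \<alpha> * q) ^ 2" by simp
  then have "0 \<le> 4 * \<alpha> * (B - (\<beta> * q - \<alpha> * q ^ 2))"
    using assms(2) by (simp add: power2_eq_square algebra_simps)
  then show ?thesis using assms(1) by (simp add: zero_le_mult_iff)
qed

lemma sqrt_41_bounds: "64/10 < sqrt 41" "sqrt 41 < 641/100"
  by (rule real_less_rsqrt, simp add: power2_eq_square) (rule real_less_lsqrt, auto simp: power2_eq_square)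

lemma bstar_bounds: "1573/10000 < bstar" "bstar < 1576/10000"
  using sqrt_41_bounds by (auto simp: bstar_def)

lemma bstar_root: "40 * bstar ^ 2 = 19 * bstar - 2"
proof -
  have "sqrt 41 ^ 2 = 41" by simp
  moreover have "80 * bstar = 19 - sqrt 41" by (simp add: bstar_def)
  then have "sqrt 41 = 19 - 80 * bstar" by simp
  ultimately have "(19 - 80 * bstar) ^ 2 = 41" by simp
  then show ?thesis by (simp add: power2_eq_square algebra_simps)
qed

lemma one_three_bstar: "one_three bstar = 2193/160000 - 1107/320000 * bstar"
proof -
  have "320000 * one_three bstar = 4386 - 1107 * bstar"
    using bstar_root unfolding one_three_def by algebra
  then show ?thesis by simp
qed

lemma one_three_le:
  assumes "0 \<le> b" "b \<le> 1/4"
  shows "one_three b \<le> one_three bstar"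
proof -
  define d where "d = (\<lambda>x::real. 3 * x * ((1 - 4 * x) * (2 - 19 * x + 40 * x ^ 2)))"
  have D: "(one_three has_real_derivative d x) (at x)" for x
    unfolding one_three_def[abs_def] d_def
    by (auto intro!: derivative_eq_intros simp: algebra_simps eval_nat_numeral)
  have fac: "2 - 19 * x + 40 * x ^ 2 = (bstar - x) * (19 - 40 * bstar - 40 * x)" for x
    using bstar_root by algebra
  show ?thesis
  proof (cases "b \<le> bstar")
    case True
    show ?thesis
    proof (rule DERIV_nonneg_imp_nondecreasing[OF True])
      fix x assume "b \<le> x" "x \<le> bstar"
      then have "0 \<le> d x" using assms bstar_bounds unfolding d_def fac by (intro mult_nonneg_nonneg) auto
      then show "\<exists>y. (one_three has_real_derivative y) (at x) \<and> 0 \<le> y" using D by blast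
    qed
  next
    case False
    then have "bstar \<le> b" by simp
    then show ?thesis
    proof (rule DERIV_nonpos_imp_nonincreasing)
      fix x assume x: "bstar \<le> x" "x \<le> b"
      have *: "(bstar - x) * (19 - 40 * bstar - 40 * x) \<le> 0"
        using x assms bstar_bounds by (intro mult_nonpos_nonneg) auto
      then have "d x \<le> 0" using x assms bstar_bounds unfolding d_def fac
        by (intro mult_nonneg_nonpos[OF _ mult_nonneg_nonpos[OF _ *]]) auto
      then show "\<exists>y. (one_three has_real_derivative y) (at x) \<and> y \<le> 0" using D by blast
    qed
  qed
qed

lemma one_three_bstar_gt: "131/10000 \<le> one_three bstar"
  using bstar_bounds by (simp add: one_three_bstar)

lemma le_of_scaled_diff:
  fixes c x y :: real
  assumes "0 < c" "0 \<le> c * (x - y)"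
  shows "y \<le> x"
  using assms by (simp add: zero_le_mult_iff)

text \<open>
  The difference is a polynomial of degree six in \<open>a\<close>. Expanded in Bernstein form on the interval \<open>[1/4, 5/11]\<close>, that is, in
  the nonnegative quantities \<open>4 a - 1\<close> and \<open>5 - 11 a\<close>, it has positive coefficients. The number 131/10000 is a rational
  bound just below the maximum in question.
\<close>

lemma discriminant_cubic:
  fixes a s :: real
  assumes "1/4 \<le> a" "a \<le> 5/11" "s = 1 - a"
  shows "(a ^ 3 + a * s ^ 2 + 6/100 * s ^ 3) ^ 2 \<le> 4 * (2 * a - (s - a) / 3 + 4/10 * s) * (131/10000)"
proof -
  define t where "t = 4 * a - 1"
  define u where "u = 5 - 11 * a"
  have tu: "0 \<le> t" "0 \<le> u" using assms by (auto simp: t_def u_def)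
  have "0 \<le> 34057 * u ^ 6 + 2235324 * t * u ^ 5 + 29671800 * t ^ 2 * u ^ 4 + 157713820 * t ^ 3 * u ^ 3
      + 372060420 * t ^ 4 * u ^ 2 + 341704218 * t ^ 5 * u + 27484201 * t ^ 6"
    using tu by (intro add_nonneg_nonneg mult_nonneg_nonneg zero_le_power) auto
  also have "\<dots> = 19929037500 * (4 * (2 * a - (s - a) / 3 + 4/10 * s) * (131/10000)
      - (a ^ 3 + a * s ^ 2 + 6/100 * s ^ 3) ^ 2)"
    unfolding assms(3) t_def u_def by (simp add: field_simps) algebra
  finally show ?thesis by (rule le_of_scaled_diff[rotated]) simp
qed

text \<open>
  A second discriminant, treated in the same Bernstein form.
\<close>

lemma discriminant_schur:
  fixes a s :: real
  assumes "1/4 \<le> a" "a \<le> 5/11" "s = 1 - a"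
  shows "(a ^ 3 + a * s ^ 2 + 2/9 * s ^ 2 * (3 * s - 2 * a)) ^ 2
    \<le> 4 * (2 * a + 8/9 * s) * (131/10000 + s ^ 4 * (s - a) / 9)"
proof -
  define t where "t = 4 * a - 1"
  define u where "u = 5 - 11 * a"
  have tu: "0 \<le> t" "0 \<le> u" using assms by (auto simp: t_def u_def)
  have "0 \<le> 39008 * u ^ 6 + 606672 * t * u ^ 5 + 4085520 * t ^ 2 * u ^ 4 + 15691040 * t ^ 3 * u ^ 3
      + 34250670 * t ^ 4 * u ^ 2 + 35067927 * t ^ 5 * u + 7762913 * t ^ 6"
    using tu by (intro add_nonneg_nonneg mult_nonneg_nonneg zero_le_power) auto
  also have "\<dots> = 1992903750 * (4 * (2 * a + 8/9 * s) * (131/10000 + s ^ 4 * (s - a) / 9)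
      - (a ^ 3 + a * s ^ 2 + 2/9 * s ^ 2 * (3 * s - 2 * a)) ^ 2)"
    unfolding assms(3) t_def u_def by (simp add: field_simps) algebra
  finally show ?thesis by (rule le_of_scaled_diff[rotated]) simp
qed

text \<open>
  Schur's inequality of degree one, in elementary symmetric form.
\<close>

lemma schur:
  fixes x y z :: real
  assumes "0 \<le> x" "0 \<le> y" "0 \<le> z"
  shows "(4 * (x * y + x * z + y * z) - (x + y + z) ^ 2) * (x + y + z) \<le> 9 * (x * y * z)"
proof -
  have *: "0 \<le> u * ((u - v) * (u - w)) + v * ((v - u) * (v - w)) + w * ((w - u) * (w - v))"
    if "0 \<le> w" "w \<le> v" "v \<le> u" for u v w :: real
  proof -
    have "0 \<le> (u - v) * ((u - v) * (u + v - w)) + w * ((u - w) * (v - w))"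
      using that by (intro add_nonneg_nonneg mult_nonneg_nonneg) auto
    also have "\<dots> = u * ((u - v) * (u - w)) + v * ((v - u) * (v - w)) + w * ((w - u) * (w - v))" by algebra
    finally show ?thesis .
  qed
  have "0 \<le> x * ((x - y) * (x - z)) + y * ((y - x) * (y - z)) + z * ((z - x) * (z - y))"
    using *[of x y z] *[of x z y] *[of y x z] *[of y z x] *[of z x y] *[of z y x] assms
    by (smt (verit) mult.commute)
  also have "\<dots> = 9 * (x * y * z) - (4 * (x * y + x * z + y * z) - (x + y + z) ^ 2) * (x + y + z)" by algebra
  finally show ?thesis by simp
qed

lemma four_part_eq:
  fixes a x y z :: real
  defines "s \<equiv> x + y + z" and "q \<equiv> x * y + x * z + y * z" and "r \<equiv> x * y * z"
  shows "four_part a x y z = q * (a ^ 3 + a * s ^ 2) - 2 * a * q ^ 2 + r * (s ^ 2 - a * s - 2 * q)"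
  unfolding four_part_def s_def q_def r_def by algebra

text \<open>
  Let \<open>a\<close> be the largest class and \<open>s\<close>, \<open>q\<close>, \<open>r\<close> the elementary symmetric functions of the other three. The value is linear in \<open>r\<close>, so
  depending on the sign of the coefficient of \<open>r\<close> it is bounded by inserting \<open>r \<le> q^2 / (3 s)\<close> or Schur's inequality. Both
  are equalities for three equal classes, where \<open>q = s^2 / 3\<close>. If \<open>a \<ge> 5/11\<close>, the resulting function of \<open>q\<close> is concave and still
  increasing at \<open>q = s^2 / 3\<close>, so that equal small classes are optimal. If \<open>a \<le> 5/11\<close>, it does not exceed 131/10000 for any
  \<open>q \<ge> 0\<close>, which is less than the maximum.
\<close>

lemma four_part_bound_max:
  fixes a x y z :: real
  assumes nn: "0 \<le> x" "0 \<le> y" "0 \<le> z" and mx: "x \<le> a" "y \<le> a" "z \<le> a" and sum: "a + x + y + z = 1"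
  shows "four_part a x y z \<le> one_three bstar"
proof (cases "x + y + z = 0")
  case True
  then have "x = 0" "y = 0" "z = 0" using nn by auto
  then show ?thesis using one_three_bstar_gt by (simp add: four_part_def)
next
  case False
  define s where "s = x + y + z"
  define q where "q = x * y + x * z + y * z"
  define r where "r = x * y * z"
  have s: "0 < s" "s = 1 - a" "1/4 \<le> a" using False nn mx sum by (auto simp: s_def)
  have a: "0 < a" using s by simp
  have q0: "0 \<le> q" using nn by (auto simp: q_def)
  have q1: "3 * q \<le> s ^ 2"
  proof -
    have "s ^ 2 - 3 * q = ((x - y) ^ 2 + (y - z) ^ 2 + (x - z) ^ 2) / 2"
      unfolding s_def q_def by (simp add: field_simps power2_eq_square)
    moreover have "0 \<le> ((x - y) ^ 2 + (y - z) ^ 2 + (x - z) ^ 2) / 2" by simp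
    ultimately show ?thesis by linarith
  qed
  have rq: "3 * (s * r) \<le> q ^ 2"
  proof -
    have "q ^ 2 - 3 * (s * r) = ((x * y - x * z) ^ 2 + (x * z - y * z) ^ 2 + (x * y - y * z) ^ 2) / 2"
      unfolding s_def q_def r_def by (simp add: field_simps power2_eq_square)
    moreover have "0 \<le> ((x * y - x * z) ^ 2 + (x * z - y * z) ^ 2 + (x * y - y * z) ^ 2) / 2" by simp
    ultimately show ?thesis by linarith
  qed
  have rs: "(4 * q - s ^ 2) * s \<le> 9 * r"
    using schur[OF nn] by (simp add: s_def q_def r_def)
  have V: "four_part a x y z = q * (a ^ 3 + a * s ^ 2) - 2 * a * q ^ 2 + r * (s ^ 2 - a * s - 2 * q)"
    unfolding s_def q_def r_def by (rule four_part_eq)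
  have V0: "one_three (s / 3) = s ^ 2 / 3 * (a ^ 3 + a * s ^ 2) - 2 * a * (s ^ 2 / 3) ^ 2
      + s ^ 3 / 27 * (s ^ 2 - a * s - 2 * (s ^ 2 / 3))"
  proof -
    have "one_three (s / 3) = four_part (1 - 3 * (s / 3)) (s / 3) (s / 3) (s / 3)"
      by (rule four_part_one_three[symmetric])
    also have "1 - 3 * (s / 3) = a" using s(2) by linarith
    also have "four_part a (s / 3) (s / 3) (s / 3) = s ^ 2 / 3 * (a ^ 3 + a * s ^ 2)
      - 2 * a * (s ^ 2 / 3) ^ 2 + s ^ 3 / 27 * (s ^ 2 - a * s - 2 * (s ^ 2 / 3))"
      by (simp add: four_part_eq power2_eq_square power3_eq_cube)
    finally show ?thesis .
  qed
  have one_three_le_bstar: "one_three (s / 3) \<le> one_three bstar" using s by (intro one_three_le) auto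
  define \<beta> where "\<beta> = a ^ 3 + a * s ^ 2"
  show ?thesis
  proof (cases "0 \<le> s ^ 2 - a * s - 2 * q")
    case True
    have "3 * (s * r) * (s ^ 2 - a * s - 2 * q) \<le> q ^ 2 * (s ^ 2 - a * s - 2 * q)"
      using rq True by (rule mult_right_mono)
    then have up: "3 * s * four_part a x y z \<le>
        3 * s * (\<beta> * q - (2 * a - (s - a) / 3) * q ^ 2) - 2 * q ^ 3"
    proof -
      have "3 * s * four_part a x y z = 3 * s * (\<beta> * q - (2 * a - (s - a) / 3) * q ^ 2) - 2 * q ^ 3
          - q ^ 2 * (s ^ 2 - a * s - 2 * q) + 3 * (s * r) * (s ^ 2 - a * s - 2 * q)"
        unfolding V \<beta>_def by (simp add: field_simps eval_nat_numeral)
      then show ?thesis using \<open>3 * (s * r) * _ \<le> _\<close> by linarith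
    qed
    have "four_part a x y z \<le> one_three bstar"
    proof (cases "a \<le> 5/11")
      case small: True
      \<comment> \<open>The cubic term is replaced by a quadratic upper bound that touches it at \<open>q = 3/10 s^2\<close>, close to the critical \<open>q\<close>.\<close>
      have "0 \<le> 2 * (q * (q - 3/10 * s ^ 2) ^ 2)" using q0 by simp
      then have "3 * s * four_part a x y z \<le>
          3 * s * ((\<beta> + 6/100 * s ^ 3) * q - (2 * a - (s - a) / 3 + 4/10 * s) * q ^ 2)"
        using up by (simp add: algebra_simps eval_nat_numeral)
      then have "four_part a x y z \<le> (\<beta> + 6/100 * s ^ 3) * q - (2 * a - (s - a) / 3 + 4/10 * s) * q ^ 2"
        using s by simp
      also have "\<dots> \<le> 131/10000"
      proof (rule quadratic_bound)
        show "0 < 2 * a - (s - a) / 3 + 4/10 * s" using s(2,3) by (simp add: field_simps)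
        show "(\<beta> + 6/100 * s ^ 3) ^ 2 \<le> 4 * (2 * a - (s - a) / 3 + 4/10 * s) * (131/10000)"
          unfolding \<beta>_def by (rule discriminant_cubic[OF s(3) small s(2)])
      qed
      finally show ?thesis using one_three_bstar_gt by simp
    next
      case large: False
      define Q where "Q = s ^ 2 / 3"
      have qQ: "q \<le> Q" using q1 by (simp add: Q_def)
      have Q0: "0 \<le> Q" by (simp add: Q_def)
      have al: "0 \<le> 2 * a - (s - a) / 3" using large s by simp
      have as: "5/9 * s ^ 2 \<le> a ^ 2"
      proof -
        have "(5/6 * s) ^ 2 \<le> a ^ 2" using large s by (intro power_mono) auto
        then have "25/36 * s ^ 2 \<le> a ^ 2" by (simp add: power_mult_distrib power2_eq_square)
        moreover have "0 \<le> s ^ 2" by simp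
        ultimately show ?thesis by linarith
      qed
      have "0 \<le> 3 * s * a * (a ^ 2 - 5/9 * s ^ 2)" using s a as by simp
      also have "\<dots> = 3 * s * (\<beta> - 2 * (2 * a - (s - a) / 3) * Q) - 2 * (3 * Q ^ 2)"
        unfolding \<beta>_def Q_def by (simp add: field_simps eval_nat_numeral)
      also have "\<dots> \<le> 3 * s * (\<beta> - (2 * a - (s - a) / 3) * (Q + q)) - 2 * (Q ^ 2 + Q * q + q ^ 2)"
      proof -
        have "(2 * a - (s - a) / 3) * (Q + q) \<le> (2 * a - (s - a) / 3) * (2 * Q)"
          using al qQ by (intro mult_left_mono) auto
        then have "3 * s * ((2 * a - (s - a) / 3) * (Q + q)) \<le> 3 * s * ((2 * a - (s - a) / 3) * (2 * Q))"
          using s by (intro mult_left_mono) auto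
        moreover have "Q * q \<le> Q * Q" "q * q \<le> Q * Q" using qQ q0 Q0 by (auto intro: mult_mono)
        ultimately show ?thesis by (simp add: algebra_simps power2_eq_square)
      qed
      finally have "0 \<le> (Q - q) * (3 * s * (\<beta> - (2 * a - (s - a) / 3) * (Q + q)) - 2 * (Q ^ 2 + Q * q + q ^ 2))"
        using qQ by simp
      also have "\<dots> = (3 * s * (\<beta> * Q - (2 * a - (s - a) / 3) * Q ^ 2) - 2 * Q ^ 3)
          - (3 * s * (\<beta> * q - (2 * a - (s - a) / 3) * q ^ 2) - 2 * q ^ 3)" by algebra
      also have "3 * s * (\<beta> * Q - (2 * a - (s - a) / 3) * Q ^ 2) - 2 * Q ^ 3 = 3 * s * one_three (s / 3)"
        unfolding V0 \<beta>_def Q_def by (simp add: field_simps eval_nat_numeral)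
      finally have "3 * s * four_part a x y z \<le> 3 * s * one_three (s / 3)" using up by linarith
      then show ?thesis using s one_three_le_bstar by simp
    qed
    then show ?thesis .
  next
    case False
    define \<gamma> where "\<gamma> = \<beta> + 2/9 * s ^ 2 * (3 * s - 2 * a)"
    define \<alpha> where "\<alpha> = 2 * a + 8/9 * s"
    have "r * (s ^ 2 - a * s - 2 * q) \<le> (4 * q - s ^ 2) * s / 9 * (s ^ 2 - a * s - 2 * q)"
      using rs False by (intro mult_right_mono_neg) auto
    then have up: "four_part a x y z \<le> \<gamma> * q - \<alpha> * q ^ 2 - s ^ 4 * (s - a) / 9"
      unfolding V \<gamma>_def \<alpha>_def \<beta>_def by (simp add: field_simps eval_nat_numeral)
    have \<alpha>: "0 < \<alpha>" unfolding \<alpha>_def using s(1) a by (intro add_pos_pos) auto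
    show ?thesis
    proof (cases "a \<le> 5/11")
      case small: True
      have "\<gamma> * q - \<alpha> * q ^ 2 \<le> 131/10000 + s ^ 4 * (s - a) / 9"
        using discriminant_schur[OF s(3) small s(2)] unfolding \<gamma>_def \<alpha>_def \<beta>_def
        by (intro quadratic_bound[OF \<alpha>[unfolded \<alpha>_def]]) (simp add: algebra_simps)
      then show ?thesis using up one_three_bstar_gt by linarith
    next
      case large: False
      define Q where "Q = s ^ 2 / 3"
      have qQ: "q \<le> Q" using q1 by (simp add: Q_def)
      \<comment> \<open>The assumption \<open>a > 5/11\<close> means \<open>a > 5/6 s\<close>; in the excess \<open>e\<close> the slope at \<open>q = s^2 / 3\<close> has positive coefficients.\<close>
      define e where "e = a - 5/6 * s"
      have e: "0 \<le> e" "a = 5/6 * s + e" using large s by (auto simp: e_def)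
      have "0 \<le> e ^ 3 + 5/2 * e ^ 2 * s + 47/36 * e * s ^ 2 + 1/216 * s ^ 3"
        using e s by (intro add_nonneg_nonneg mult_nonneg_nonneg zero_le_power) auto
      also have "\<dots> = \<gamma> - \<alpha> * (2 * Q)"
        unfolding \<gamma>_def \<alpha>_def \<beta>_def Q_def e(2) by (simp add: field_simps eval_nat_numeral)
      also have "\<dots> \<le> \<gamma> - \<alpha> * (Q + q)" using \<alpha> qQ by simp
      finally have "0 \<le> (Q - q) * (\<gamma> - \<alpha> * (Q + q))" using qQ by simp
      also have "\<dots> = (\<gamma> * Q - \<alpha> * Q ^ 2) - (\<gamma> * q - \<alpha> * q ^ 2)" by algebra
      finally have "four_part a x y z \<le> \<gamma> * Q - \<alpha> * Q ^ 2 - s ^ 4 * (s - a) / 9" using up by linarith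
      also have "\<dots> = one_three (s / 3)"
        unfolding V0 \<gamma>_def \<alpha>_def \<beta>_def Q_def by (simp add: field_simps eval_nat_numeral)
      finally show ?thesis using one_three_le_bstar by simp
    qed
  qed
qed

text \<open>
  By symmetry any of the four classes may be taken as the largest.
\<close>

lemma four_part_bound:
  fixes a x y z :: real
  assumes nn: "0 \<le> a" "0 \<le> x" "0 \<le> y" "0 \<le> z" and sum: "a + x + y + z = 1"
  shows "four_part a x y z \<le> one_three bstar"
proof -
  have sym: "four_part x a y z = four_part a x y z" "four_part y x a z = four_part a x y z"
    "four_part z x y a = four_part a x y z" unfolding four_part_def by algebra+
  consider "x \<le> a" "y \<le> a" "z \<le> a" | "a \<le> x" "y \<le> x" "z \<le> x" | "x \<le> y" "a \<le> y" "z \<le> y"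
    | "x \<le> z" "y \<le> z" "a \<le> z" by linarith
  then show ?thesis
  proof cases
    case 1
    then show ?thesis using four_part_bound_max[of x y z a] assms by simp
  next
    case 2
    then show ?thesis using four_part_bound_max[of a y z x] assms sym by simp
  next
    case 3
    then show ?thesis using four_part_bound_max[of x a z y] assms sym by simp
  next
    case 4
    then show ?thesis using four_part_bound_max[of x y a z] assms sym by simp
  qed
qed

lemma sqrt_41_irrational: "sqrt 41 \<notin> \<rat>"
proof
  assume "sqrt 41 \<in> \<rat>"
  then obtain m n :: nat where mn: "n \<noteq> 0" "\<bar>sqrt 41\<bar> = m / n" "coprime m n"
    by (rule Rats_abs_nat_div_natE)
  have p: "prime (41::nat)" by simp
  have "real m = sqrt 41 * n" using mn by (simp add: field_simps)
  then have "real m ^ 2 = 41 * real n ^ 2" by (simp add: power_mult_distrib)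
  then have "real (m ^ 2) = real (41 * n ^ 2)" by simp
  then have eq: "m ^ 2 = 41 * n ^ 2" by (simp only: of_nat_eq_iff)
  then have "41 dvd m ^ 2" by simp
  then have dm: "41 dvd m" using p prime_dvd_power by blast
  then obtain k where "m = 41 * k" by blast
  then have "n ^ 2 = 41 * k ^ 2" using eq by (simp add: power2_eq_square)
  then have "41 dvd n ^ 2" by simp
  then have "41 dvd n" using p prime_dvd_power by blast
  then have "41 dvd gcd m n" using dm by simp
  then show False using mn(3) by simp
qed

lemma one_three_bstar_irrational: "one_three bstar \<notin> \<rat>"
proof
  assume r: "one_three bstar \<in> \<rat>"
  have "80 * bstar = 19 - sqrt 41" by (simp add: bstar_def)
  then have "sqrt 41 = 19 - 80 * bstar" by simp
  also have "bstar = (2193/160000 - one_three bstar) * (320000/1107)" by (simp add: one_three_bstar)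
  also have "19 - 80 * ((2193/160000 - one_three bstar) * (320000/1107)) \<in> \<rat>"
    by (intro Rats_diff Rats_mult r Rats_divide) auto
  finally show False using sqrt_41_irrational by simp
qed

lemma inducibility_clique_free_5_K311:
  "inducibility_clique_free 5 (K_partite [3, 1, 1]) = 20 * one_three bstar"
proof -
  have val: "profile_sum divided_power (mset [3, 1, 1]) [a, x, y, z] = four_part a x y z / 6" for a x y z
  proof -
    have "mset [3, 1, 1] = {#3, 1, 1::nat#}" by simp
    then show ?thesis unfolding four_part_def
      by (simp only: profile_sum_311) (simp add: field_simps eval_nat_numeral)
  qed
  let ?xs = "[1 - 3 * bstar, bstar, bstar, bstar]"
  have xs: "?xs \<in> prob_vectors 4" using bstar_bounds by (auto simp: prob_vectors_def)
  have "profile_sum divided_power (mset [3, 1, 1]) ys \<le> profile_sum divided_power (mset [3, 1, 1]) ?xs" if "ys \<in> prob_vectors 4" for ys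
  proof -
    obtain a x y z where ys: "ys = [a, x, y, z]"
      using \<open>ys \<in> prob_vectors 4\<close> by (auto simp: prob_vectors_def length_Suc_conv eval_nat_numeral)
    have "four_part a x y z \<le> one_three bstar"
      by (rule four_part_bound) (use that in \<open>auto simp: prob_vectors_def ys\<close>)
    then show ?thesis unfolding ys val four_part_one_three by simp
  qed
  then have "inducibility_clique_free (Suc 4) (K_partite [3, 1, 1]) =
      fact (sum_list [3, 1, 1]) * profile_sum divided_power (mset [3, 1, 1]) ?xs"
    by (intro inducibility_clique_free_eq xs) auto
  then show ?thesis unfolding val four_part_one_three by (simp add: fact_numeral)
qed

section \<open>Minimality among complete partite graphs\<close>

theorem proposition1p13:
  shows "(\<exists>F :: (nat \<times> nat) pair_pre_digraph. complete_partite F \<and> rational_yet_irrational F) \<and>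
    (complete_partite (K_partite [3, 1, 1]) \<and> rational_yet_irrational (K_partite [3, 1, 1]) \<and>
     (\<forall>F :: 'a pair_pre_digraph. complete_partite F \<and> rational_yet_irrational F \<longrightarrow>
        digraph_iso (with_proj (K_partite [3, 1, 1])) (with_proj F) \<or>
        card (pverts (K_partite [3, 1, 1])) < card (pverts F))) \<and>
    inducibility (K_partite [3, 1, 1]) = 216 / 625 \<and>
    inducibility_clique_free 5 (K_partite [3, 1, 1]) \<notin> \<rat>"
proof -
  have i: "inducibility (K_partite [3, 1, 1]) = 216/625"
    unfolding inducibility_def by (rule limI[OF max_density_K311_limit])
  have i5: "inducibility_clique_free 5 (K_partite [3, 1, 1]) \<notin> \<rat>"
  proof
    assume "inducibility_clique_free 5 (K_partite [3, 1, 1]) \<in> \<rat>"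
    then have "20 * one_three bstar / 20 \<in> \<rat>"
      unfolding inducibility_clique_free_5_K311 by (rule Rats_divide) simp
    then show False using one_three_bstar_irrational by simp
  qed
  have cp: "complete_partite (K_partite [3, 1, 1])" by (rule complete_partite_K_partite) auto
  have "inducibility (K_partite [3, 1, 1]) \<in> \<rat>" unfolding i by simp
  moreover have "\<exists>k\<ge>2. inducibility_clique_free k (K_partite [3, 1, 1]) \<notin> \<rat>"
    by (rule exI[of _ 5]) (use i5 in simp)
  ultimately have ryi: "rational_yet_irrational (K_partite [3, 1, 1])"
    unfolding rational_yet_irrational_def by blast
  have "digraph_iso (with_proj (K_partite [3, 1, 1])) (with_proj F) \<or>
        card (pverts (K_partite [3, 1, 1])) < card (pverts F)"
    if F: "complete_partite F" "rational_yet_irrational F" for F :: "'a pair_pre_digraph"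
  proof (rule ccontr)
    assume neg: "\<not> ?thesis"
    obtain as where as: "0 \<notin> set as" "digraph_iso (with_proj (K_partite as)) (with_proj F)"
      using F(1) unfolding complete_partite_def by blast
    have "card (pverts F) = sum_list as"
      using induces_card[OF digraph_iso_K_partite_induces(2)[OF as(2)]] by (simp add: card_K_partite)
    then have "sum_list as \<le> 5" using neg by (simp add: card_K_partite)
    moreover have "mset as \<noteq> {#3, 1, 1#}"
      using digraph_iso_K_partite_mset[OF as(2) _ as(1), of "[3, 1, 1]"] neg by auto
    ultimately have rat: "inducibility_clique_free (Suc q) F \<in> \<rat>" if "1 \<le> q" for q
      using inducibility_clique_free_rational[OF that as(1)] inducibility_clique_free_iso[OF as(2)] by simp
    obtain k where k: "2 \<le> k" "inducibility_clique_free k F \<notin> \<rat>"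
      using F(2) unfolding rational_yet_irrational_def by blast
    then obtain q where "k = Suc q" "1 \<le> q" by (cases k) auto
    then show False using rat[of q] k(2) by simp
  qed
  then show ?thesis using i i5 cp ryi by blast
qed

end
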